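(* Let $G$ be a bridgeless graph on $n$ vertices, exactly $n_2$ of which have degree $2$. Then $G$ is $A$-flow-connected for every finite abelian group $A$ satisfying $$|A|\ge \left\lfloor 3\log_2(n-n_2+2)\right\rfloor.$$
   Context: Graphs are finite; parallel edges are allowed. A cycle is a connected 2-regular graph (two parallel edges form a cycle of length 2). Fix an arbitrary orientation $D$ of $G$; for a vertex $v$ let $E_D^+(v)$ and $E_D^-(v)$ be the sets of edges directed out of and into $v$. An $A$-flow on $G$ (always nowhere-zero here) is a function $f:E(G)\to A\setminus\{0_A\}$ with $\sum_{e\in E_D^+(v)}f(e)-\sum_{e\in E_D^-(v)}f(e)=0_A$ for every vertex $v$. (Flows given with different orientations are identified by negating the value of every edge whose orientation is reversed, so the choice of $D$ does not matter.) Two $A$-flows $f',f''$ are adjacent if there is a cycle $C$ in $G$ such that $f'(e)=f''(e)$ for all $e\notin E(C)$, and equivalent if they are joined by a finite sequence of $A$-flows in which consecutive flows are adjacent. $G$ is $A$-flow-connected if all its $A$-flows are pairwise equivalent (vacuously true if $G$ has no $A$-flow). *)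

theory Defs
  imports
    Complex_Main
    "HOL-Library.Cardinality"
    "HOL-Library.FuncSet"
    "Graph_Theory.Graph_Theory"
begin

text \<open>
  A finite graph with parallel edges (and loops) together with an arbitrary fixed orientation of it
  is the same thing as a finite digraph \<open>D\<close>: the arcs are the edges of the graph, and the direction
  of an arc is the one chosen by the orientation. Degrees, connectivity, bridges and cycles are
  those of the underlying undirected graph and ignore the directions.
\<close>

text \<open>A loop contributes to both summands and hence counts twice.\<close>

definition degree :: "('v, 'e) pre_digraph \<Rightarrow> 'v \<Rightarrow> nat" where
  "degree D v = in_degree D v + out_degree D v"

text \<open>
  A bridge is an edge that separates its two ends. Reachability in \<^term>\<open>mk_symmetric D\<close> is
  reachability in the underlying undirected graph of \<open>D\<close>.
\<close>

definition is_bridge :: "('v, 'e) pre_digraph \<Rightarrow> 'e \<Rightarrow> bool" where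
  "is_bridge D e \<longleftrightarrow>
     e \<in> arcs D \<and>
     \<not> reachable (with_proj (mk_symmetric (pre_digraph.del_arc D e))) (tail D e) (head D e)"

definition bridgeless :: "('v, 'e) pre_digraph \<Rightarrow> bool" where
  "bridgeless D \<longleftrightarrow> (\<forall>e\<in>arcs D. \<not> is_bridge D e)"

text \<open>
  Connectivity here is that of the underlying undirected graph, which in particular must be
  nonempty; a cycle need not be a directed cycle of the orientation.
\<close>

definition cycle_in :: "('v, 'e) pre_digraph \<Rightarrow> ('v, 'e) pre_digraph \<Rightarrow> bool" where
  "cycle_in D C \<longleftrightarrow>
     subgraph C D \<and> Digraph_Component.connected C \<and> (\<forall>v\<in>verts C. degree C v = 2)"

text \<open>
  Flows are extensional (they take the value \<^const>\<open>undefined\<close> outside \<^term>\<open>arcs D\<close>), so that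
  two flows are equal iff they agree on every edge.
\<close>

definition flows :: "('v, 'e) pre_digraph \<Rightarrow> ('e \<Rightarrow> 'a::ab_group_add) set" where
  "flows D =
     {f \<in> arcs D \<rightarrow>\<^sub>E UNIV - {0}.
        \<forall>v\<in>verts D. (\<Sum>e\<in>out_arcs D v. f e) - (\<Sum>e\<in>in_arcs D v. f e) = 0}"

definition flow_adjacent ::
    "('v, 'e) pre_digraph \<Rightarrow> ('e \<Rightarrow> 'a::ab_group_add) \<Rightarrow> ('e \<Rightarrow> 'a) \<Rightarrow> bool" where
  "flow_adjacent D f g \<longleftrightarrow>
     f \<in> flows D \<and> g \<in> flows D \<and>
     (\<exists>C. cycle_in D C \<and> (\<forall>e\<in>arcs D - arcs C. f e = g e))"

definition flow_equivalent ::
    "('v, 'e) pre_digraph \<Rightarrow> ('e \<Rightarrow> 'a::ab_group_add) \<Rightarrow> ('e \<Rightarrow> 'a) \<Rightarrow> bool" where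
  "flow_equivalent D = (flow_adjacent D)\<^sup>*\<^sup>*"

text \<open>The group \<open>A\<close> is the type \<^typ>\<open>'a\<close>, passed as a type argument.\<close>

definition flow_connected ::
    "'a::ab_group_add itself \<Rightarrow> ('v, 'e) pre_digraph \<Rightarrow> bool" where
  "flow_connected A D \<longleftrightarrow>
     (\<forall>f\<in>flows D. \<forall>g\<in>flows D. flow_equivalent D f (g :: 'e \<Rightarrow> 'a))"

end

theory Submission
  imports Defs
begin

text \<open>
  The proof is by induction on the number of arcs: contract a short cycle \<open>C\<close>, join the two
  restricted flows in the contraction \<open>G / C\<close>, and lift the moves one at a time. A move in
  \<open>G / C\<close> adds some \<open>c\<close> along a cycle \<open>C'\<close> that passes through the contracted vertex at most once.
  In \<open>G\<close> it may be a trail between two vertices of \<open>C\<close>, and it is closed up by one of the two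
  paths of \<open>C\<close> between them, the shorter one, with at most half of the \<open>l\<close> arcs of \<open>C\<close>. The move may
  create a zero on \<open>C\<close>; to prevent this, some \<open>s\<close> is first added along \<open>C\<close>. Each arc of \<open>C\<close>
  forbids one value of \<open>s\<close>, each arc of the chosen path a second one, so a suitable \<open>s\<close> exists as
  soon as \<open>|A| > l + l div 2\<close>. Two flows with the same restriction to \<open>G / C\<close> differ by a constant
  along \<open>C\<close> and are adjacent (\<open>connected_flows_if_short_cycle_contracted\<close>).

  It remains to find a short cycle. A vertex with exactly two arcs, neither of them a loop, is
  first removed by contracting one of the arcs, which does not affect flows
  (\<open>connected_flows_if_series_arc_contracted\<close>), and a loop is a cycle of length one. Otherwise
  every end of an arc has degree at least three, unless there is no flow at all. If there are \<open>m\<close>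
  vertices of degree at least three and \<open>m + 2 < 3 * 2 ^ r\<close>, then the Moore bound yields a cycle
  of length at most \<open>2 * r\<close> (\<open>short_signed_cycle_exists\<close>), so that \<open>|A| > 3 * r\<close> suffices. For the least such \<open>r\<close>
  this is what the logarithmic bound gives (\<open>log_bound\<close>). Contractions never increase \<open>m\<close>, so one
  \<open>r\<close> serves throughout the induction.

  Cycles are handled as integer circulations with values in \<open>{-1, 0, 1}\<close>. The lifted move only has
  to be such a circulation, not a cycle: it splits into disjoint cycles, along which \<open>c\<close> can be
  added successively (\<open>unit_circulation_steps\<close>).
\<close>

section \<open>Chains, boundaries and circulations\<close>

text \<open>
  The multiple \<open>n a\<close>, the action of the integers on an abelian group.
\<close>

definition zmul :: "int \<Rightarrow> 'a::ab_group_add \<Rightarrow> 'a" where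
  "zmul n a = ((+) a ^^ nat n) 0 - ((+) a ^^ nat (- n)) 0"

lemma zmul_0 [simp]: "zmul 0 a = 0"
  by (simp add: zmul_def)

lemma zmul_1 [simp]: "zmul 1 a = a"
  by (simp add: zmul_def)

lemma zmul_minus: "zmul (- n) a = - zmul n a"
  by (simp add: zmul_def)

lemma zmul_minus_1 [simp]: "zmul (- 1) a = - a"
  by (simp add: zmul_def)

lemma zmul_Suc: "zmul (n + 1) a = zmul n a + a"
proof (cases "n \<ge> 0")
  case True
  then have "nat (n + 1) = Suc (nat n)" "nat (- n) = 0" "nat (- (n + 1)) = 0"
    by auto
  then show ?thesis
    unfolding zmul_def by (simp only: funpow.simps) simp
next
  case False
  then have "nat (- n) = Suc (nat (- (n + 1)))" "nat n = 0" "nat (n + 1) = 0"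
    by auto
  then show ?thesis
    unfolding zmul_def by (simp only: funpow.simps) simp
qed

lemma zmul_add: "zmul (m + n) a = zmul m a + zmul n a"
proof (induction n rule: int_induct[where k = 0])
  case base
  then show ?case by simp
next
  case (step1 i)
  then show ?case
    using zmul_Suc[of "m + i" a] zmul_Suc[of i a] by (simp add: algebra_simps)
next
  case (step2 i)
  then show ?case
    using zmul_Suc[of "m + i - 1" a] zmul_Suc[of "i - 1" a] by (simp add: algebra_simps)
qed

lemma zmul_diff: "zmul (m - n) a = zmul m a - zmul n a"
  using zmul_add[of m "- n" a] by (simp add: zmul_minus)

lemma zmul_sum: "zmul (\<Sum>i\<in>I. n i) a = (\<Sum>i\<in>I. zmul (n i) a)"
  by (induction I rule: infinite_finite_induct) (simp_all add: zmul_add)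

lemma zmul_int: "zmul n m = n * (m::int)"
  by (induction n rule: int_induct[where k = 0])
    (use zmul_Suc[of _ m] in \<open>auto simp: zmul_diff algebra_simps\<close>)

definition boundary ::
    "'e set \<Rightarrow> ('e \<Rightarrow> 'v) \<Rightarrow> ('e \<Rightarrow> 'v) \<Rightarrow> ('e \<Rightarrow> 'a::ab_group_add) \<Rightarrow> 'v \<Rightarrow> 'a" where
  "boundary E t h f v = (\<Sum>e\<in>E. (if t e = v then f e else 0) - (if h e = v then f e else 0))"

lemma boundary_add:
  "boundary E t h (\<lambda>e. f e + g e) v = boundary E t h f v + boundary E t h g v"
  by (simp add: boundary_def sum.distrib[symmetric] cong: if_cong)
    (rule sum.cong, auto)

lemma boundary_uminus: "boundary E t h (\<lambda>e. - f e) v = - boundary E t h f v"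
  by (simp add: boundary_def sum_negf[symmetric]) (rule sum.cong, auto)

lemma boundary_diff:
  "boundary E t h (\<lambda>e. f e - g e) v = boundary E t h f v - boundary E t h g v"
  using boundary_add[of E t h f "\<lambda>e. - g e" v] by (simp add: boundary_uminus)

lemma boundary_zmul: "boundary E t h (\<lambda>e. zmul (\<chi> e) a) v = zmul (boundary E t h \<chi> v) a"
  by (simp add: boundary_def zmul_sum zmul_diff) (rule sum.cong, auto)

lemma boundary_0: "boundary E t h (\<lambda>e. 0) v = 0"
  by (simp add: boundary_def)

lemma boundary_mono:
  assumes "finite E" "F \<subseteq> E" "\<And>e. e \<notin> F \<Longrightarrow> f e = 0"
  shows "boundary E t h f v = boundary F t h f v"
  unfolding boundary_def using assms by (intro sum.mono_neutral_right) auto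

lemma boundary_single:
  assumes "finite E" "e \<in> E"
  shows "boundary E t h (\<lambda>x. if x = e then a else 0) v =
    (if t e = v then a else 0) - (if h e = v then a else 0)"
proof -
  have "boundary E t h (\<lambda>x. if x = e then a else 0) v =
      boundary {e} t h (\<lambda>x. if x = e then a else 0) v"
    using assms by (intro boundary_mono) auto
  then show ?thesis by (simp add: boundary_def)
qed

text \<open>
  Vanishing outside \<open>E\<close> makes equality of chains equality of functions and lets a chain on a
  contraction be read as a chain on the original graph.
\<close>

definition circulation ::
    "'e set \<Rightarrow> ('e \<Rightarrow> 'v) \<Rightarrow> ('e \<Rightarrow> 'v) \<Rightarrow> ('e \<Rightarrow> 'a::ab_group_add) \<Rightarrow> bool" where
  "circulation E t h f \<longleftrightarrow> (\<forall>e. e \<notin> E \<longrightarrow> f e = 0) \<and> (\<forall>v. boundary E t h f v = 0)"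

definition nz_flow ::
    "'e set \<Rightarrow> ('e \<Rightarrow> 'v) \<Rightarrow> ('e \<Rightarrow> 'v) \<Rightarrow> ('e \<Rightarrow> 'a::ab_group_add) \<Rightarrow> bool" where
  "nz_flow E t h f \<longleftrightarrow> circulation E t h f \<and> (\<forall>e\<in>E. f e \<noteq> 0)"

lemma circulation_add:
  "circulation E t h f \<Longrightarrow> circulation E t h g \<Longrightarrow> circulation E t h (\<lambda>e. f e + g e)"
  by (simp add: circulation_def boundary_add)

lemma circulation_diff:
  "circulation E t h f \<Longrightarrow> circulation E t h g \<Longrightarrow> circulation E t h (\<lambda>e. f e - g e)"
  by (simp add: circulation_def boundary_diff)

lemma circulation_zmul:
  "circulation E t h \<chi> \<Longrightarrow> circulation E t h (\<lambda>e. zmul (\<chi> e) a)"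
  by (simp add: circulation_def boundary_zmul)

section \<open>Signed cycles\<close>

text \<open>
  An integer chain \<open>\<chi>\<close> redirects the arcs of its support so that all its values become positive;
  \<open>src\<close> and \<open>dst\<close> are the ends of an arc after this redirection.
\<close>

definition src :: "('e \<Rightarrow> 'v) \<Rightarrow> ('e \<Rightarrow> 'v) \<Rightarrow> ('e \<Rightarrow> int) \<Rightarrow> 'e \<Rightarrow> 'v" where
  "src t h \<chi> e = (if \<chi> e > 0 then t e else h e)"

definition dst :: "('e \<Rightarrow> 'v) \<Rightarrow> ('e \<Rightarrow> 'v) \<Rightarrow> ('e \<Rightarrow> int) \<Rightarrow> 'e \<Rightarrow> 'v" where
  "dst t h \<chi> e = (if \<chi> e > 0 then h e else t e)"

lemma boundary_redirect:
  "boundary E t h f v = (\<Sum>e\<in>E.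
     (if src t h \<chi> e = v then (if \<chi> e > 0 then f e else - f e) else 0) -
     (if dst t h \<chi> e = v then (if \<chi> e > 0 then f e else - f e) else 0))"
  unfolding boundary_def src_def dst_def by (intro sum.cong) auto

text \<open>
  A signed cycle is a cycle with a direction of traversal, encoded as the integer circulation that
  is \<open>1\<close> on the arcs traversed forwards and \<open>-1\<close> on those traversed backwards. The vertices
  \<open>v 0, \<dots>, v (l - 1)\<close> and the arcs \<open>a 0, \<dots>, a (l - 1)\<close> are listed in the order of traversal. For
  \<open>l = 1\<close> this is a loop.
\<close>

definition signed_cycle ::
    "'e set \<Rightarrow> ('e \<Rightarrow> 'v) \<Rightarrow> ('e \<Rightarrow> 'v) \<Rightarrow> ('e \<Rightarrow> int) \<Rightarrow> nat \<Rightarrow> (nat \<Rightarrow> 'v) \<Rightarrow> (nat \<Rightarrow> 'e) \<Rightarrow> bool" where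
  "signed_cycle E t h \<gamma> l v a \<longleftrightarrow>
     0 < l \<and> inj_on v {..<l} \<and> v l = v 0 \<and>
     (\<forall>i<l. a i \<in> E \<and> \<bar>\<gamma> (a i)\<bar> = 1 \<and> src t h \<gamma> (a i) = v i \<and> dst t h \<gamma> (a i) = v (Suc i)) \<and>
     (\<forall>e. e \<notin> a ` {..<l} \<longrightarrow> \<gamma> e = 0)"

context
  fixes E :: "'e set" and t h :: "'e \<Rightarrow> 'v" and \<gamma> :: "'e \<Rightarrow> int" and l v a
  assumes C: "signed_cycle E t h \<gamma> l v a"
begin

lemma signed_cycle_facts:
  "0 < l" "inj_on v {..<l}" "v l = v 0"
  "\<And>i. i < l \<Longrightarrow> a i \<in> E" "\<And>i. i < l \<Longrightarrow> \<bar>\<gamma> (a i)\<bar> = 1"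
  "\<And>i. i < l \<Longrightarrow> src t h \<gamma> (a i) = v i" "\<And>i. i < l \<Longrightarrow> dst t h \<gamma> (a i) = v (Suc i)"
  "\<And>e. e \<notin> a ` {..<l} \<Longrightarrow> \<gamma> e = 0"
  using C unfolding signed_cycle_def by auto

lemma signed_cycle_inj: "inj_on a {..<l}"
proof (rule inj_onI)
  fix i j assume ij: "i \<in> {..<l}" "j \<in> {..<l}" "a i = a j"
  then have "v i = v j"
    using signed_cycle_facts(6) by (metis lessThan_iff)
  with ij show "i = j"
    using signed_cycle_facts(2) by (auto dest: inj_onD)
qed

lemma signed_cycle_support: "{e. \<gamma> e \<noteq> 0} = a ` {..<l}"
  using signed_cycle_facts(5,8) by fastforce

lemma signed_cycle_card: "card {e. \<gamma> e \<noteq> 0} = l"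
  unfolding signed_cycle_support by (simp add: card_image signed_cycle_inj)

lemma signed_cycle_unit: "\<bar>\<gamma> e\<bar> \<le> 1"
  using signed_cycle_facts(5,8) by (cases "e \<in> a ` {..<l}") fastforce+

text \<open>
  A chain supported on the cycle is a sequence of coefficients \<open>x\<close>, one for each step of the
  traversal, and its boundary is the sequence of their differences.
\<close>

lemma boundary_on_signed_cycle:
  fixes f :: "'e \<Rightarrow> 'a::ab_group_add"
  assumes "finite E" "\<And>e. e \<notin> a ` {..<l} \<Longrightarrow> f e = 0"
    and x: "\<And>i. i < l \<Longrightarrow> f (a i) = zmul (\<gamma> (a i)) (x i)"
  shows "boundary E t h f u =
    (\<Sum>i<l. (if v i = u then x i else 0) - (if v (Suc i) = u then x i else 0))"
proof -
  have "boundary E t h f u = boundary (a ` {..<l}) t h f u"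
    using assms signed_cycle_facts(4) by (intro boundary_mono) auto
  also have "\<dots> = (\<Sum>i<l. (if v i = u then x i else 0) - (if v (Suc i) = u then x i else 0))"
    unfolding boundary_redirect[where \<chi> = \<gamma>] sum.reindex[OF signed_cycle_inj] o_def
  proof (rule sum.cong)
    fix i assume "i \<in> {..<l}"
    then have i: "i < l" by simp
    have "(if \<gamma> (a i) > 0 then f (a i) else - f (a i)) = x i"
      using x[OF i] signed_cycle_facts(5)[OF i] by (auto simp: abs_if split: if_splits)
    then show "(if src t h \<gamma> (a i) = u then if 0 < \<gamma> (a i) then f (a i) else - f (a i) else 0) -
       (if dst t h \<gamma> (a i) = u then if 0 < \<gamma> (a i) then f (a i) else - f (a i) else 0) =
      (if v i = u then x i else 0) - (if v (Suc i) = u then x i else 0)"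
      using signed_cycle_facts(6,7)[OF i] by simp
  qed simp
  finally show ?thesis .
qed

lemma signed_cycle_circulation:
  assumes "finite E"
  shows "circulation E t h \<gamma>"
proof -
  have "boundary E t h \<gamma> u = 0" for u
  proof -
    have "boundary E t h \<gamma> u =
        (\<Sum>i<l. (if v i = u then 1 else 0) - (if v (Suc i) = u then 1 else 0))"
      using assms signed_cycle_facts(8)
      by (intro boundary_on_signed_cycle) (auto simp: zmul_int)
    also have "\<dots> = (if v 0 = u then 1 else 0) - (if v l = u then 1 else 0)"
      by (rule sum_lessThan_telescope')
    finally show ?thesis using signed_cycle_facts(3) by simp
  qed
  moreover have "\<gamma> e = 0" if "e \<notin> E" for e
    using that signed_cycle_facts(4) by (intro signed_cycle_facts(8)) auto
  ultimately show ?thesis by (auto simp: circulation_def)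
qed

text \<open>Conservation at \<open>v (i + 1)\<close> forces equal coefficients on steps \<open>i\<close> and \<open>i + 1\<close>.\<close>

lemma circulation_on_signed_cycle:
  fixes d :: "'e \<Rightarrow> 'a::ab_group_add"
  assumes "finite E" "circulation E t h d" "\<And>e. e \<notin> a ` {..<l} \<Longrightarrow> d e = 0"
  shows "\<exists>c. \<forall>e. d e = zmul (\<gamma> e) c"
proof -
  define x where "x i = zmul (\<gamma> (a i)) (d (a i))" for i
  have x: "d (a i) = zmul (\<gamma> (a i)) (x i)" if "i < l" for i
    using signed_cycle_facts(5)[OF that] by (auto simp: x_def abs_if zmul_minus split: if_splits)
  have "x i = x 0" if "i < l" for i
    using that
  proof (induction i)
    case (Suc i)
    have "boundary E t h d (v (Suc i)) = 0"
      using assms(2) by (simp add: circulation_def)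
    then have "0 = (\<Sum>j<l. (if v j = v (Suc i) then x j else 0) -
        (if v (Suc j) = v (Suc i) then x j else 0))"
      using boundary_on_signed_cycle[OF assms(1,3) x] by simp
    also have "\<dots> = (\<Sum>j<l. (if j = Suc i then x j else 0) - (if j = i then x j else 0))"
    proof (rule sum.cong)
      fix j assume "j \<in> {..<l}"
      then have "v j = v (Suc i) \<longleftrightarrow> j = Suc i"
        using Suc.prems signed_cycle_facts(2) by (auto dest: inj_onD)
      moreover have "v (Suc j) = v (Suc i) \<longleftrightarrow> j = i"
      proof (cases "Suc j < l")
        case True
        then show ?thesis
          using Suc.prems signed_cycle_facts(2) by (auto dest: inj_onD)
      next
        case False
        then have "Suc j = l" using \<open>j \<in> {..<l}\<close> by auto
        then show ?thesis
          using Suc.prems signed_cycle_facts(1,2,3) inj_onD[of v "{..<l}" 0 "Suc i"] by auto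
      qed
      ultimately show "(if v j = v (Suc i) then x j else 0) -
          (if v (Suc j) = v (Suc i) then x j else 0) =
          (if j = Suc i then x j else 0) - (if j = i then x j else 0)"
        by simp
    qed simp
    also have "\<dots> = x (Suc i) - x i"
      using Suc.prems by (simp add: sum_subtractf)
    finally show ?case using Suc by simp
  qed simp
  then have "d (a i) = zmul (\<gamma> (a i)) (x 0)" if "i < l" for i
    using x[OF that] that by metis
  then have "d e = zmul (\<gamma> e) (x 0)" for e
    using assms(3)[of e] signed_cycle_facts(8)[of e] by (cases "e \<in> a ` {..<l}") auto
  then show ?thesis by blast
qed

end

text \<open>
  Conservation lets one leave every vertex that has been entered, so a walk along the arcs
  redirected by \<open>\<chi>\<close> never gets stuck and runs into itself. Leaving each vertex always by the same
  arc makes the walk an orbit of a self-map of a finite set; its first period is a cycle.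
\<close>

lemma conformal_signed_cycle_exists:
  assumes fin: "finite E" and circ: "circulation E t h (\<chi> :: 'e \<Rightarrow> int)" and e0: "\<chi> e0 \<noteq> 0"
  obtains \<gamma> l v a where "signed_cycle E t h \<gamma> l v a" "\<And>e. \<gamma> e \<noteq> 0 \<Longrightarrow> \<gamma> e = sgn (\<chi> e)"
proof -
  let ?src = "src t h \<chi>" and ?dst = "dst t h \<chi>"
  define S where "S = {e. \<chi> e \<noteq> 0}"
  define U where "U = ?src ` S"
  have SE: "S \<subseteq> E" using circ by (auto simp: S_def circulation_def)
  then have finU: "finite U" using fin by (auto simp: U_def dest: finite_subset)
  have continue: "?dst e \<in> U" if "e \<in> S" for e
  proof (rule ccontr)
    assume no: "?dst e \<notin> U"
    let ?w = "?dst e"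
    have nosrc: "\<chi> x = 0" if "?src x = ?w" for x
      using no that by (force simp: U_def S_def)
    have "0 = boundary E t h \<chi> ?w"
      using circ by (simp add: circulation_def)
    also have "\<dots> = - (\<Sum>x\<in>E. if ?dst x = ?w then \<bar>\<chi> x\<bar> else 0)"
      unfolding boundary_redirect[where \<chi> = \<chi>] sum_negf[symmetric]
      by (intro sum.cong) (auto dest: nosrc)
    finally have "(\<Sum>x\<in>E. if ?dst x = ?w then \<bar>\<chi> x\<bar> else 0) = 0" by simp
    then have "\<forall>x\<in>E. (if ?dst x = ?w then \<bar>\<chi> x\<bar> else 0) = 0"
      using fin by (subst (asm) sum_nonneg_eq_0_iff) auto
    moreover have "e \<in> E" "\<chi> e \<noteq> 0" using that SE by (auto simp: S_def)
    ultimately show False by fastforce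
  qed
  have "\<exists>e. e \<in> S \<and> ?src e = u" if "u \<in> U" for u
    using that by (auto simp: U_def)
  then obtain out where out: "\<And>u. u \<in> U \<Longrightarrow> out u \<in> S \<and> ?src (out u) = u"
    by metis
  define nxt where "nxt u = ?dst (out u)" for u
  have nxtU: "nxt u \<in> U" if "u \<in> U" for u
    using continue out[OF that] by (simp add: nxt_def)
  have orbU: "(nxt ^^ k) u \<in> U" if "u \<in> U" for u k
    using that by (induction k) (auto simp: nxtU)
  define w0 where "w0 = ?src e0"
  have w0: "w0 \<in> U" using e0 by (auto simp: w0_def U_def S_def)
  have "\<not> inj (\<lambda>k. (nxt ^^ k) w0)"
    using finU orbU[OF w0] by (meson finite_subset image_subsetI infinite_UNIV_nat finite_imageD)
  then obtain i j where ij: "i < j" "(nxt ^^ i) w0 = (nxt ^^ j) w0"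
    unfolding inj_def by (metis linorder_neqE_nat)
  define w where "w = (nxt ^^ i) w0"
  have w: "w \<in> U" using orbU[OF w0] by (simp add: w_def)
  have "(nxt ^^ (j - i)) w = w"
    using ij funpow_add[of "j - i" i nxt] by (simp add: w_def)
  then have ex: "\<exists>p. 0 < p \<and> (nxt ^^ p) w = w" using ij by (intro exI[of _ "j - i"]) simp
  define p where "p = (LEAST p. 0 < p \<and> (nxt ^^ p) w = w)"
  have p: "0 < p" "(nxt ^^ p) w = w"
    using LeastI_ex[OF ex] by (simp_all add: p_def)
  have least: "p \<le> q" if "0 < q" "(nxt ^^ q) w = w" for q
    using that by (simp add: p_def Least_le)
  define v where "v k = (nxt ^^ k) w" for k
  define a where "a k = out (v k)" for k
  define \<gamma> where "\<gamma> e = (if e \<in> a ` {..<p} then sgn (\<chi> e) else 0)" for e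
  have vU: "v k \<in> U" for k using orbU[OF w] by (simp add: v_def)
  have aS: "a k \<in> S" and srca: "?src (a k) = v k" and dsta: "?dst (a k) = v (Suc k)" for k
    using out[OF vU] by (auto simp: a_def v_def nxt_def)
  have inj: "inj_on v {..<p}"
  proof (rule linorder_inj_onI)
    fix x y assume xy: "x < y" "x \<in> {..<p}" "y \<in> {..<p}"
    show "v x \<noteq> v y"
    proof
      assume eq: "v x = v y"
      have "(nxt ^^ (p - y + x)) w = (nxt ^^ (p - y)) (v x)"
        by (simp add: v_def funpow_add)
      also have "\<dots> = (nxt ^^ (p - y + y)) w"
        unfolding eq by (simp add: v_def funpow_add)
      also have "\<dots> = w" using xy p by simp
      finally show False using least[of "p - y + x"] xy by auto
    qed
  qed auto
  have "signed_cycle E t h \<gamma> p v a"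
    unfolding signed_cycle_def
  proof (intro conjI allI impI)
    fix k assume k: "k < p"
    then have eq: "\<gamma> (a k) = sgn (\<chi> (a k))" by (auto simp: \<gamma>_def)
    show "a k \<in> E" using aS SE by auto
    show "\<bar>\<gamma> (a k)\<bar> = 1" using aS[of k] eq by (simp add: S_def abs_sgn_eq)
    show "src t h \<gamma> (a k) = v k" using srca eq by (simp add: src_def)
    show "dst t h \<gamma> (a k) = v (Suc k)" using dsta eq by (simp add: dst_def)
  qed (use p inj in \<open>auto simp: v_def \<gamma>_def\<close>)
  moreover have "\<gamma> e = sgn (\<chi> e)" if "\<gamma> e \<noteq> 0" for e
    using that by (auto simp: \<gamma>_def split: if_splits)
  ultimately show thesis by (rule that)
qed

section \<open>Moves along cycles\<close>

definition cycle_step ::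
    "'e set \<Rightarrow> ('e \<Rightarrow> 'v) \<Rightarrow> ('e \<Rightarrow> 'v) \<Rightarrow> ('e \<Rightarrow> 'a::ab_group_add) \<Rightarrow> ('e \<Rightarrow> 'a) \<Rightarrow> bool" where
  "cycle_step E t h f g \<longleftrightarrow> nz_flow E t h f \<and> nz_flow E t h g \<and>
     (\<exists>\<gamma> l v a c. signed_cycle E t h \<gamma> l v a \<and> g = (\<lambda>e. f e + zmul (\<gamma> e) c))"

text \<open>
  A circulation with values in \<open>{-1, 0, 1}\<close> is a sum of signed cycles with disjoint supports.
  Adding \<open>c\<close> along these cycles one by one changes each arc at most once, so that every
  intermediate value is a value of the first or of the last flow and hence nonzero. Lifting a
  cycle from a contraction therefore only requires a unit circulation.
\<close>

lemma unit_circulation_steps: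
  fixes f :: "'e \<Rightarrow> 'a::ab_group_add"
  assumes fin: "finite E"
  shows "nz_flow E t h f \<Longrightarrow> circulation E t h \<chi> \<Longrightarrow> (\<And>e. \<bar>\<chi> e\<bar> \<le> 1) \<Longrightarrow>
    (\<And>e. e \<in> E \<Longrightarrow> f e + zmul (\<chi> e) c \<noteq> 0) \<Longrightarrow>
    (cycle_step E t h)\<^sup>*\<^sup>* f (\<lambda>e. f e + zmul (\<chi> e) c)"
proof (induction "card {e. \<chi> e \<noteq> 0}" arbitrary: f \<chi> rule: less_induct)
  case less
  show ?case
  proof (cases "\<exists>e. \<chi> e \<noteq> 0")
    case False
    then show ?thesis by simp
  next
    case True
    then obtain e0 where "\<chi> e0 \<noteq> 0" by blast
    then obtain \<gamma> l v a where C: "signed_cycle E t h \<gamma> l v a"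
      and conf: "\<And>e. \<gamma> e \<noteq> 0 \<Longrightarrow> \<gamma> e = sgn (\<chi> e)"
      using conformal_signed_cycle_exists[OF fin less.prems(2)] by metis
    have conf': "\<gamma> e = \<chi> e" if "\<gamma> e \<noteq> 0" for e
      using conf[OF that] less.prems(3)[of e] that by (auto simp: sgn_if abs_if split: if_splits)
    define g where "g e = f e + zmul (\<gamma> e) c" for e
    define \<chi>' where "\<chi>' e = \<chi> e - \<gamma> e" for e
    have circ\<gamma>: "circulation E t h \<gamma>"
      using signed_cycle_circulation[OF C fin] .
    have g: "nz_flow E t h g"
      unfolding nz_flow_def
    proof
      show "circulation E t h g"
        unfolding g_def using less.prems(1)
        by (intro circulation_add circulation_zmul circ\<gamma>) (simp add: nz_flow_def)
      show "\<forall>e\<in>E. g e \<noteq> 0"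
      proof
        fix e assume "e \<in> E"
        then show "g e \<noteq> 0"
          using less.prems(1) less.prems(4)[of e] conf'[of e]
          by (cases "\<gamma> e = 0") (auto simp: g_def nz_flow_def)
      qed
    qed
    then have step: "cycle_step E t h f g"
      using less.prems(1) C unfolding cycle_step_def g_def by blast
    have rest: "g e + zmul (\<chi>' e) c = f e + zmul (\<chi> e) c" for e
      by (simp add: g_def \<chi>'_def zmul_diff)
    have "finite {e. \<chi> e \<noteq> 0}"
      using less.prems(2) by (intro finite_subset[OF _ fin]) (auto simp: circulation_def)
    moreover have "{e. \<chi>' e \<noteq> 0} \<subset> {e. \<chi> e \<noteq> 0}"
    proof
      show "{e. \<chi>' e \<noteq> 0} \<subseteq> {e. \<chi> e \<noteq> 0}"
        using conf' by (auto simp: \<chi>'_def)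
      have "\<gamma> (a 0) \<noteq> 0"
        using signed_cycle_facts(5)[OF C signed_cycle_facts(1)[OF C]] by auto
      then have "a 0 \<in> {e. \<chi> e \<noteq> 0}" "a 0 \<notin> {e. \<chi>' e \<noteq> 0}"
        using conf'[of "a 0"] by (simp_all add: \<chi>'_def)
      then show "{e. \<chi>' e \<noteq> 0} \<noteq> {e. \<chi> e \<noteq> 0}"
        by blast
    qed
    ultimately have "card {e. \<chi>' e \<noteq> 0} < card {e. \<chi> e \<noteq> 0}"
      by (rule psubset_card_mono)
    moreover have "circulation E t h \<chi>'"
      unfolding \<chi>'_def by (intro circulation_diff less.prems circ\<gamma>)
    moreover have "\<bar>\<chi>' e\<bar> \<le> 1" for e
      using less.prems(3)[of e] conf'[of e] by (cases "\<gamma> e = 0") (auto simp: \<chi>'_def)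
    moreover have "g e + zmul (\<chi>' e) c \<noteq> 0" if "e \<in> E" for e
      unfolding rest using less.prems(4)[OF that] .
    ultimately have "(cycle_step E t h)\<^sup>*\<^sup>* g (\<lambda>e. g e + zmul (\<chi>' e) c)"
      using less.hyps g by blast
    with step show ?thesis
      unfolding rest by (rule converse_rtranclp_into_rtranclp)
  qed
qed

lemma nz_flow_add_zmul:
  assumes "nz_flow E t h f" "circulation E t h \<chi>" "\<And>e. e \<in> E \<Longrightarrow> f e + zmul (\<chi> e) c \<noteq> 0"
  shows "nz_flow E t h (\<lambda>e. f e + zmul (\<chi> e) c)"
  using assms circulation_add[OF _ circulation_zmul[OF assms(2)], of f c]
  by (simp add: nz_flow_def)

definition connected_flows ::
    "'a::ab_group_add itself \<Rightarrow> 'e set \<Rightarrow> ('e \<Rightarrow> 'v) \<Rightarrow> ('e \<Rightarrow> 'v) \<Rightarrow> bool" where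
  "connected_flows A E t h \<longleftrightarrow> (\<forall>f g :: 'e \<Rightarrow> 'a.
     nz_flow E t h f \<longrightarrow> nz_flow E t h g \<longrightarrow> (cycle_step E t h)\<^sup>*\<^sup>* f g)"

section \<open>Contraction\<close>

text \<open>
  The two paths between two vertices of a cycle have no arc in common, so the shorter one uses at
  most half of the arcs.
\<close>

lemma short_path_on_signed_cycle:
  assumes fin: "finite E" and C: "signed_cycle E t h \<gamma> l v a"
    and xy: "x \<in> v ` {..<l}" "y \<in> v ` {..<l}"
  obtains \<tau> :: "'e \<Rightarrow> int" where "\<And>e. \<bar>\<tau> e\<bar> \<le> 1" "\<And>e. \<gamma> e = 0 \<Longrightarrow> \<tau> e = 0"
    "\<And>u. boundary E t h \<tau> u = (if u = x then 1 else 0) - (if u = y then 1 else 0)"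
    "2 * card {e. \<tau> e \<noteq> 0} \<le> l"
proof -
  note cyc = signed_cycle_facts[OF C]
  have path: "\<exists>\<tau>. (\<forall>e. \<tau> e = 0 \<or> \<tau> e = \<gamma> e) \<and> (\<forall>u. boundary E t h \<tau> u =
      (if u = v i then 1 else 0) - (if u = v j then 1 else 0))" if "i \<le> j" "j < l" for i j
  proof -
    define \<tau> where "\<tau> e = (if e \<in> a ` {i..<j} then \<gamma> e else 0)" for e
    have "boundary E t h \<tau> u = (if u = v i then 1 else 0) - (if u = v j then 1 else 0)" for u
    proof -
      have "a k \<in> a ` {i..<j} \<longleftrightarrow> k \<in> {i..<j}" if "k < l" for k
        using that \<open>j < l\<close> inj_on_image_mem_iff[OF signed_cycle_inj[OF C], of k "{i..<j}"]
        by (metis atLeastLessThan_iff lessThan_iff less_trans subsetI)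
      then have "boundary E t h \<tau> u = (\<Sum>k<l.
          (if v k = u then of_bool (k \<in> {i..<j}) else 0) -
          (if v (Suc k) = u then of_bool (k \<in> {i..<j}) else 0))"
        using that by (intro boundary_on_signed_cycle[OF C fin])
          (auto simp: \<tau>_def zmul_int)
      also have "\<dots> = (\<Sum>k\<in>{i..<j}. (if v k = u then 1 else 0) - (if v (Suc k) = u then 1 else 0))"
        using \<open>j < l\<close> by (intro sum.mono_neutral_cong_right) auto
      also have "\<dots> = (\<Sum>k\<in>{i..<j}. - ((if v (Suc k) = u then 1 else 0) - (if v k = u then 1 else 0)))"
        by (intro sum.cong) auto
      also have "\<dots> = - ((if v j = u then 1 else 0) - (if v i = u then 1 else 0))"
        unfolding sum_negf by (subst sum_Suc_diff'[OF \<open>i \<le> j\<close>]) simp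
      finally show ?thesis by auto
    qed
    then show ?thesis by (intro exI[of _ \<tau>]) (auto simp: \<tau>_def)
  qed
  obtain i j where ij: "x = v i" "y = v j" "i < l" "j < l" using xy by auto
  have "\<exists>\<tau> \<sigma>. \<bar>\<sigma>\<bar> = 1 \<and> (\<forall>e. \<tau> e = 0 \<or> \<tau> e = \<sigma> * \<gamma> e) \<and> (\<forall>u. boundary E t h \<tau> u =
      (if u = x then 1 else 0) - (if u = y then 1 else 0))"
  proof (cases "i \<le> j")
    case True
    then show ?thesis using path[of i j] ij by (metis abs_1 mult_1)
  next
    case False
    then obtain \<tau> where \<tau>: "\<forall>e. \<tau> e = 0 \<or> \<tau> e = \<gamma> e"
      "\<forall>u. boundary E t h \<tau> u = (if u = v j then 1 else 0) - (if u = v i then 1 else 0)"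
      using path[of j i] ij by auto
    then show ?thesis
      using ij by (intro exI[of _ "\<lambda>e. - \<tau> e"] exI[of _ "-1"]) (auto simp: boundary_uminus)
  qed
  then obtain \<tau> \<sigma> where \<tau>: "\<bar>\<sigma>\<bar> = 1" "\<And>e. \<tau> e = 0 \<or> \<tau> e = \<sigma> * \<gamma> e"
      "\<And>u. boundary E t h \<tau> u = (if u = x then 1 else 0) - (if u = y then 1 else 0)"
    by blast
  \<comment> \<open>the complementary path, traversed in the other direction\<close>
  define \<tau>' where "\<tau>' e = \<tau> e - \<sigma> * \<gamma> e" for e
  have "boundary E t h (\<lambda>e. \<sigma> * \<gamma> e) u = 0" for u
    using boundary_zmul[of E t h \<gamma> \<sigma> u] signed_cycle_circulation[OF C fin]
    by (simp add: zmul_int circulation_def mult.commute)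
  then have \<tau>': "boundary E t h \<tau>' u = (if u = x then 1 else 0) - (if u = y then 1 else 0)" for u
    unfolding \<tau>'_def boundary_diff by (simp add: \<tau>(3))
  have \<gamma>1: "\<bar>\<sigma> * \<gamma> e\<bar> \<le> 1" for e
    using signed_cycle_unit[OF C] \<tau>(1) by (simp add: abs_mult)
  have unit: "\<bar>\<tau> e\<bar> \<le> 1" "\<bar>\<tau>' e\<bar> \<le> 1" for e
    using \<tau>(2)[of e] \<gamma>1[of e] by (auto simp: \<tau>'_def)
  have supp: "\<gamma> e = 0 \<Longrightarrow> \<tau> e = 0" "\<gamma> e = 0 \<Longrightarrow> \<tau>' e = 0" for e
    using \<tau>(2)[of e] by (auto simp: \<tau>'_def)
  have finC: "finite {e. \<gamma> e \<noteq> 0}"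
    unfolding signed_cycle_support[OF C] by simp
  have "card {e. \<tau> e \<noteq> 0} + card {e. \<tau>' e \<noteq> 0} = card ({e. \<tau> e \<noteq> 0} \<union> {e. \<tau>' e \<noteq> 0})"
  proof (rule card_Un_disjoint[symmetric])
    show "finite {e. \<tau> e \<noteq> 0}" "finite {e. \<tau>' e \<noteq> 0}"
      using supp by (auto intro: finite_subset[OF _ finC])
    show "{e. \<tau> e \<noteq> 0} \<inter> {e. \<tau>' e \<noteq> 0} = {}"
      using \<tau>(2) by (force simp: \<tau>'_def)
  qed
  also have "\<dots> \<le> card {e. \<gamma> e \<noteq> 0}"
    using supp by (intro card_mono finC) auto
  finally have "card {e. \<tau> e \<noteq> 0} + card {e. \<tau>' e \<noteq> 0} \<le> l"
    by (simp add: signed_cycle_card[OF C])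
  then consider "2 * card {e. \<tau> e \<noteq> 0} \<le> l" | "2 * card {e. \<tau>' e \<noteq> 0} \<le> l"
    by linarith
  then show thesis
  proof cases
    case 1
    show ?thesis by (rule that[OF unit(1) supp(1) \<tau>(3) 1])
  next
    case 2
    show ?thesis by (rule that[OF unit(2) supp(2) \<tau>' 2])
  qed
qed

definition merge :: "'v set \<Rightarrow> 'v \<Rightarrow> ('e \<Rightarrow> 'v) \<Rightarrow> 'e \<Rightarrow> 'v" where
  "merge X x0 t e = (if t e \<in> X then x0 else t e)"

locale contraction =
  fixes E K :: "'e set" and t h :: "'e \<Rightarrow> 'v" and X :: "'v set" and x0 :: 'v
  assumes finE: "finite E" and finX: "finite X" and KE: "K \<subseteq> E" and x0: "x0 \<in> X"
    and KX: "\<And>e. e \<in> K \<Longrightarrow> t e \<in> X \<and> h e \<in> X"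
begin

abbreviation "t' \<equiv> merge X x0 t"
abbreviation "h' \<equiv> merge X x0 h"

lemma boundary_contract:
  fixes f :: "'e \<Rightarrow> 'a::ab_group_add"
  shows "boundary (E - K) t' h' f w =
    (if w = x0 then \<Sum>x\<in>X. boundary E t h f x else if w \<in> X then 0 else boundary E t h f w)"
proof -
  consider "w = x0" | "w \<noteq> x0" "w \<in> X" | "w \<notin> X" by blast
  then show ?thesis
  proof cases
    case 1
    have "(\<Sum>x\<in>X. boundary E t h f x) = (\<Sum>e\<in>E. \<Sum>x\<in>X.
        (if t e = x then f e else 0) - (if h e = x then f e else 0))"
      unfolding boundary_def by (rule sum.swap)
    also have "\<dots> = (\<Sum>e\<in>E. (if t e \<in> X then f e else 0) - (if h e \<in> X then f e else 0))"
      using finX by (intro sum.cong) (auto simp: sum_subtractf)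
    also have "\<dots> = (\<Sum>e\<in>E - K. (if t e \<in> X then f e else 0) - (if h e \<in> X then f e else 0))"
      using finE KX by (intro sum.mono_neutral_right) auto
    also have "\<dots> = boundary (E - K) t' h' f w"
      unfolding boundary_def using 1 x0 by (intro sum.cong) (auto simp: merge_def)
    finally show ?thesis using 1 by simp
  next
    case 2
    then show ?thesis
      unfolding boundary_def by (simp add: merge_def) (intro sum.neutral, auto)
  next
    case 3
    have "boundary E t h f w = boundary (E - K) t h f w"
      unfolding boundary_def using finE KX 3 by (intro sum.mono_neutral_right) auto
    also have "\<dots> = boundary (E - K) t' h' f w"
      unfolding boundary_def using 3 x0 by (intro sum.cong) (auto simp: merge_def)
    finally show ?thesis using 3 x0 by auto
  qed
qed

definition restrict_flow :: "('e \<Rightarrow> 'a::ab_group_add) \<Rightarrow> 'e \<Rightarrow> 'a" where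
  "restrict_flow f e = (if e \<in> K then 0 else f e)"

lemma nz_flow_restrict:
  assumes "nz_flow E t h f"
  shows "nz_flow (E - K) t' h' (restrict_flow f)"
proof -
  have "boundary (E - K) t' h' (restrict_flow f) w = boundary (E - K) t' h' f w" for w
    unfolding boundary_def restrict_flow_def by (intro sum.cong) auto
  then show ?thesis
    using assms by (auto simp: nz_flow_def circulation_def boundary_contract restrict_flow_def)
qed

text \<open>
  A cycle passes through the contracted vertex at most once, so that in the original graph it is a
  closed trail or a trail with both ends in \<open>X\<close>.
\<close>

lemma boundary_lifted_cycle:
  assumes C: "signed_cycle (E - K) t' h' \<gamma> l v a"
  obtains x y where "x \<in> X" "y \<in> X"
    "\<And>u. boundary E t h \<gamma> u = (if u = x then 1 else 0) - (if u = y then 1 else 0)"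
proof -
  note cyc = signed_cycle_facts[OF C]
  have circ: "circulation (E - K) t' h' \<gamma>"
    using signed_cycle_circulation[OF C] finE by simp
  have out: "boundary E t h \<gamma> u = 0" if "u \<notin> X" for u
    using circ boundary_contract[of \<gamma> u] x0 that by (auto simp: circulation_def split: if_splits)
  let ?s = "\<lambda>i. src t h \<gamma> (a i)" and ?d = "\<lambda>i. dst t h \<gamma> (a i)"
  have "boundary E t h \<gamma> u = boundary (a ` {..<l}) t h \<gamma> u" for u
    using cyc(4,8) by (intro boundary_mono finE) auto
  also have "boundary (a ` {..<l}) t h \<gamma> u =
      (\<Sum>i<l. (if ?s i = u then 1 else 0) - (if ?d i = u then 1 else 0))" for u
    unfolding boundary_redirect[where \<chi> = \<gamma>] sum.reindex[OF signed_cycle_inj[OF C]] o_def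
    by (intro sum.cong refl) (use cyc(5) in \<open>force simp: abs_if split: if_splits\<close>)
  finally have bd: "boundary E t h \<gamma> u =
      (\<Sum>i<l. if ?s i = u then 1 else 0) - (\<Sum>i<l. if ?d i = u then 1 else 0)" for u
    by (simp add: sum_subtractf)
  have s: "?s i \<in> X \<Longrightarrow> v i = x0" "v i = x0 \<Longrightarrow> ?s i \<in> X" if "i < l" for i
    using cyc(6)[OF that] x0 by (auto simp: src_def merge_def split: if_splits)
  have d: "?d i \<in> X \<Longrightarrow> v (Suc i) = x0" "v (Suc i) = x0 \<Longrightarrow> ?d i \<in> X" if "i < l" for i
    using cyc(7)[OF that] x0 by (auto simp: dst_def merge_def split: if_splits)
  show thesis
  proof (cases "\<exists>k<l. v k = x0")
    case False
    then have no: "v i \<noteq> x0" "v (Suc i) \<noteq> x0" if "i < l" for i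
      using that cyc(1,3) by (auto, metis Suc_lessI)
    have "boundary E t h \<gamma> u = 0" for u
    proof (cases "u \<in> X")
      case True
      then have "?s i \<noteq> u" "?d i \<noteq> u" if "i < l" for i
        using no[OF that] s(1)[OF that] d(1)[OF that] by auto
      then show ?thesis unfolding bd by simp
    qed (rule out)
    then show ?thesis using that[of x0 x0] x0 by simp
  next
    case True
    then obtain k where k: "k < l" "v k = x0" by blast
    \<comment> \<open>the cycle leaves the contracted vertex by step \<open>k\<close> and enters it by the preceding step \<open>k'\<close>\<close>
    define k' where "k' = (if k = 0 then l - 1 else k - 1)"
    have k': "k' < l" "v (Suc k') = x0"
      using k cyc(1,3) by (auto simp: k'_def)
    have uniq: "i = k" if "i < l" "v i = x0" for i
      using that k cyc(2) by (auto dest: inj_onD)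
    have uniq': "i = k'" if "i < l" "v (Suc i) = x0" for i
    proof (cases "Suc i < l")
      case True
      then have "Suc i = k" using uniq that by blast
      then show ?thesis by (auto simp: k'_def)
    next
      case False
      then have "Suc i = l" using that by simp
      then have "k = 0" using uniq[of 0] that cyc(1,3) by simp
      with \<open>Suc i = l\<close> show ?thesis by (auto simp: k'_def)
    qed
    have X: "?s k \<in> X" "?d k' \<in> X" using s(2) d(2) k k' by auto
    have "boundary E t h \<gamma> u = (if u = ?s k then 1 else 0) - (if u = ?d k' then 1 else 0)" for u
    proof (cases "u \<in> X")
      case True
      have "?s i \<noteq> u" if "i < l" "i \<noteq> k" for i
        using that True s(1)[OF that(1)] uniq[OF that(1)] by blast
      then have "(\<Sum>i<l. if ?s i = u then 1 else (0::int)) = (\<Sum>i<l. if i = k then if ?s k = u then 1 else 0 else 0)"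
        by (intro sum.cong) auto
      moreover have "?d i \<noteq> u" if "i < l" "i \<noteq> k'" for i
        using that True d(1)[OF that(1)] uniq'[OF that(1)] by blast
      then have "(\<Sum>i<l. if ?d i = u then 1 else (0::int)) =
          (\<Sum>i<l. if i = k' then if ?d k' = u then 1 else 0 else 0)"
        by (intro sum.cong) auto
      ultimately show ?thesis
        unfolding bd using k k' by auto
    next
      case False
      then have "u \<noteq> ?s k" "u \<noteq> ?d k'" using X by auto
      then show ?thesis using out[OF False] by simp
    qed
    then show ?thesis using that X by blast
  qed
qed

text \<open>
  A sequence of moves in the contracted graph lifts move by move if every trail with both ends in
  \<open>X\<close> can be completed inside \<open>K\<close> to a move of the original graph. It then remains to join flows
  that differ on \<open>K\<close> only.
\<close>

lemma connected_flows_if_contraction: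
  fixes A :: "'a::ab_group_add itself"
  assumes conn: "connected_flows A (E - K) t' h'"
    and lift: "\<And>(f :: 'e \<Rightarrow> 'a) \<gamma> x y c. nz_flow E t h f \<Longrightarrow> (\<And>e. \<bar>\<gamma> e\<bar> \<le> 1) \<Longrightarrow>
      (\<And>e. e \<notin> E - K \<Longrightarrow> \<gamma> e = 0) \<Longrightarrow> x \<in> X \<Longrightarrow> y \<in> X \<Longrightarrow>
      (\<And>u. boundary E t h \<gamma> u = (if u = x then 1 else 0) - (if u = y then 1 else 0)) \<Longrightarrow>
      (\<And>e. e \<in> E - K \<Longrightarrow> f e + zmul (\<gamma> e) c \<noteq> 0) \<Longrightarrow>
      \<exists>g. nz_flow E t h g \<and> (cycle_step E t h)\<^sup>*\<^sup>* f g \<and> (\<forall>e\<in>E - K. g e = f e + zmul (\<gamma> e) c)"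
    and fibre: "\<And>f g :: 'e \<Rightarrow> 'a. nz_flow E t h f \<Longrightarrow> nz_flow E t h g \<Longrightarrow>
      (\<And>e. e \<notin> K \<Longrightarrow> f e = g e) \<Longrightarrow> (cycle_step E t h)\<^sup>*\<^sup>* f g"
  shows "connected_flows A E t h"
  unfolding connected_flows_def
proof (intro allI impI)
  fix f g :: "'e \<Rightarrow> 'a"
  assume f: "nz_flow E t h f" and g: "nz_flow E t h g"
  have "\<exists>f'. nz_flow E t h f' \<and> restrict_flow f' = H \<and> (cycle_step E t h)\<^sup>*\<^sup>* f f'"
    if "(cycle_step (E - K) t' h')\<^sup>*\<^sup>* (restrict_flow f) H" for H
    using that
  proof (induction rule: rtranclp_induct)
    case base
    then show ?case using f by blast
  next
    case (step F H)
    then obtain f' where f': "nz_flow E t h f'" "restrict_flow f' = F"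
      "(cycle_step E t h)\<^sup>*\<^sup>* f f'"
      by blast
    obtain \<gamma> l v a c where C: "signed_cycle (E - K) t' h' \<gamma> l v a"
      and H: "H = (\<lambda>e. F e + zmul (\<gamma> e) c)" and nzH: "nz_flow (E - K) t' h' H"
      using step.hyps(2) unfolding cycle_step_def by blast
    obtain x y where xy: "x \<in> X" "y \<in> X"
      "\<And>u. boundary E t h \<gamma> u = (if u = x then 1 else 0) - (if u = y then 1 else 0)"
      using boundary_lifted_cycle[OF C] by blast
    have F: "F e = f' e" if "e \<in> E - K" for e
      using f'(2) that by (auto simp: restrict_flow_def)
    have "\<exists>g. nz_flow E t h g \<and> (cycle_step E t h)\<^sup>*\<^sup>* f' g \<and>
        (\<forall>e\<in>E - K. g e = f' e + zmul (\<gamma> e) c)"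
    proof (rule lift[OF f'(1) _ _ xy])
      show "\<bar>\<gamma> e\<bar> \<le> 1" for e by (rule signed_cycle_unit[OF C])
      show "\<gamma> e = 0" if "e \<notin> E - K" for e
        using signed_cycle_circulation[OF C] finE that by (simp add: circulation_def)
      show "f' e + zmul (\<gamma> e) c \<noteq> 0" if "e \<in> E - K" for e
        using nzH F[OF that, symmetric] that by (simp add: nz_flow_def H)
    qed
    then obtain g where g: "nz_flow E t h g" "(cycle_step E t h)\<^sup>*\<^sup>* f' g"
      "\<And>e. e \<in> E - K \<Longrightarrow> g e = f' e + zmul (\<gamma> e) c"
      by blast
    have "restrict_flow g e = H e" for e
    proof (cases "e \<in> E - K")
      case True
      then show ?thesis using g(3) F by (simp add: restrict_flow_def H)
    next
      case False
      then show ?thesis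
        using nzH g(1) by (auto simp: restrict_flow_def nz_flow_def circulation_def)
    qed
    then show ?case
      using g f' by (intro exI[of _ g]) (auto intro: rtranclp_trans)
  qed
  moreover have "(cycle_step (E - K) t' h')\<^sup>*\<^sup>* (restrict_flow f) (restrict_flow g)"
    using conn nz_flow_restrict f g by (auto simp: connected_flows_def)
  ultimately obtain f' where f': "nz_flow E t h f'" "restrict_flow f' = restrict_flow g"
    "(cycle_step E t h)\<^sup>*\<^sup>* f f'"
    by blast
  have "f' e = g e" if "e \<notin> K" for e
    using fun_cong[OF f'(2), of e] that by (simp add: restrict_flow_def)
  then have "(cycle_step E t h)\<^sup>*\<^sup>* f' g"
    using fibre f' g by blast
  with f' show "(cycle_step E t h)\<^sup>*\<^sup>* f g" by (auto intro: rtranclp_trans)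
qed

end

lemma contraction_signed_cycle:
  assumes finE: "finite E" and C: "signed_cycle E t h \<gamma> l v a"
  shows "contraction E (a ` {..<l}) t h (v ` {..<l}) (v 0)"
proof
  note cyc = signed_cycle_facts[OF C]
  show "v 0 \<in> v ` {..<l}" "a ` {..<l} \<subseteq> E" using cyc(1,4) by auto
  fix e assume "e \<in> a ` {..<l}"
  then obtain i where i: "i < l" "e = a i" by blast
  have "v i \<in> v ` {..<l}" using i by auto
  moreover have "v (Suc i) \<in> v ` {..<l}"
    using i cyc(1,3) by (cases "Suc i = l") auto
  ultimately show "t e \<in> v ` {..<l} \<and> h e \<in> v ` {..<l}"
    using cyc(6,7)[OF i(1)] i(2) by (auto simp: src_def dst_def split: if_splits)
qed (use finE in auto)

text \<open>
  Let \<open>l\<close> be the length of the cycle. A move in the contraction is completed by the shorter path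
  on the cycle, which has at most \<open>l div 2\<close> arcs. Before the move a shift by \<open>s\<close> along the whole
  cycle makes room for it: each arc of the cycle excludes the one \<open>s\<close> that makes its value zero, and
  each arc of the path also the one that makes its value zero after the move. So at most
  \<open>l + l div 2\<close> values of \<open>s\<close> are excluded.
\<close>

lemma connected_flows_if_short_cycle_contracted:
  fixes A :: "'a::{ab_group_add, finite} itself" and E :: "'e set" and t h :: "'e \<Rightarrow> 'v"
  assumes finE: "finite E" and C: "signed_cycle E t h \<gamma>\<^sub>C l v a"
    and short: "l + l div 2 < CARD('a)"
    and conn: "connected_flows A (E - a ` {..<l})
      (merge (v ` {..<l}) (v 0) t) (merge (v ` {..<l}) (v 0) h)"
  shows "connected_flows A E t h"
proof -
  note cyc = signed_cycle_facts[OF C]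
  define K where "K = a ` {..<l}"
  define X where "X = v ` {..<l}"
  have circC: "circulation E t h \<gamma>\<^sub>C" by (rule signed_cycle_circulation[OF C finE])
  interpret contraction E K t h X "v 0"
    unfolding K_def X_def by (rule contraction_signed_cycle[OF finE C])
  have \<gamma>K: "\<bar>\<gamma>\<^sub>C e\<bar> = 1" if "e \<in> K" for e using that cyc(5) by (auto simp: K_def)
  have \<gamma>0: "\<gamma>\<^sub>C e = 0" if "e \<notin> K" for e using that cyc(8) by (simp add: K_def)
  have cardK: "card K = l" by (simp add: K_def card_image signed_cycle_inj[OF C])
  show ?thesis
  proof (rule connected_flows_if_contraction)
    show "connected_flows A (E - K) t' h'" using conn by (simp add: K_def X_def)
  next
    fix f :: "'e \<Rightarrow> 'a" and \<gamma> x y c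
    assume f: "nz_flow E t h f" and \<gamma>1: "\<And>e. \<bar>\<gamma> e\<bar> \<le> 1"
      and \<gamma>out: "\<And>e. e \<notin> E - K \<Longrightarrow> \<gamma> e = 0" and xy: "x \<in> X" "y \<in> X"
      and bd\<gamma>: "\<And>u. boundary E t h \<gamma> u = (if u = x then 1 else 0) - (if u = y then 1 else 0)"
      and nz: "\<And>e. e \<in> E - K \<Longrightarrow> f e + zmul (\<gamma> e) c \<noteq> 0"
    obtain \<tau> :: "'e \<Rightarrow> int" where \<tau>1: "\<And>e. \<bar>\<tau> e\<bar> \<le> 1" and \<tau>out: "\<And>e. \<gamma>\<^sub>C e = 0 \<Longrightarrow> \<tau> e = 0"
      and bd\<tau>: "\<And>u. boundary E t h \<tau> u = (if u = y then 1 else 0) - (if u = x then 1 else 0)"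
      and half: "2 * card {e. \<tau> e \<noteq> 0} \<le> l"
      using short_path_on_signed_cycle[OF finE C, of y x] xy unfolding X_def by metis
    have \<tau>K: "\<tau> e = 0" if "e \<notin> K" for e using \<tau>out \<gamma>0 that by blast
    define \<chi> where "\<chi> e = \<gamma> e + \<tau> e" for e
    have "boundary E t h \<chi> u = 0" for u
      unfolding \<chi>_def boundary_add bd\<gamma> bd\<tau> by simp
    then have \<chi>: "circulation E t h \<chi>"
      using \<gamma>out \<tau>K KE by (auto simp: circulation_def \<chi>_def)
    have \<chi>K: "\<chi> e = \<tau> e" if "e \<in> K" for e using that \<gamma>out by (simp add: \<chi>_def)
    have \<chi>E: "\<chi> e = \<gamma> e" if "e \<notin> K" for e using that \<tau>K by (simp add: \<chi>_def)
    have \<chi>1: "\<bar>\<chi> e\<bar> \<le> 1" for e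
      using \<chi>K \<chi>E \<gamma>1 \<tau>1 by (cases "e \<in> K") auto
    \<comment> \<open>the values of \<open>s\<close> that put a zero on the cycle before the move, and those that do so after it\<close>
    define bad1 where "bad1 = (\<lambda>e. - zmul (\<gamma>\<^sub>C e) (f e)) ` K"
    define bad2 where "bad2 = (\<lambda>e. - zmul (\<gamma>\<^sub>C e) (f e + zmul (\<tau> e) c)) ` {e. \<tau> e \<noteq> 0}"
    have finK: "finite K" using finE KE by (rule rev_finite_subset)
    have "finite {e. \<tau> e \<noteq> 0}" using \<tau>K by (intro finite_subset[OF _ finK]) auto
    then have "card bad2 \<le> card {e. \<tau> e \<noteq> 0}"
      unfolding bad2_def by (rule card_image_le)
    then have "card bad2 \<le> l div 2" using half by linarith
    moreover have "card bad1 \<le> l"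
      unfolding bad1_def cardK[symmetric] by (rule card_image_le[OF finK])
    ultimately have "card (bad1 \<union> bad2) < CARD('a)"
      using card_Un_le[of bad1 bad2] short by linarith
    then have "bad1 \<union> bad2 \<noteq> UNIV" by auto
    then obtain s where s: "s \<notin> bad1" "s \<notin> bad2" by blast
    have eq_bad: "s = - zmul (\<gamma>\<^sub>C e) b" if "e \<in> K" "b + zmul (\<gamma>\<^sub>C e) s = 0" for e b
    proof -
      have "\<gamma>\<^sub>C e = 1 \<or> \<gamma>\<^sub>C e = - 1" using \<gamma>K[OF that(1)] by linarith
      then show ?thesis
      proof
        assume "\<gamma>\<^sub>C e = 1"
        then show ?thesis using that(2) by (simp add: eq_neg_iff_add_eq_0 add.commute)
      next
        assume "\<gamma>\<^sub>C e = - 1"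
        then show ?thesis using that(2) by simp
      qed
    qed
    define f1 where "f1 e = f e + zmul (\<gamma>\<^sub>C e) s" for e
    have nz1: "f e + zmul (\<gamma>\<^sub>C e) s \<noteq> 0" if "e \<in> E" for e
    proof (cases "e \<in> K")
      case True
      then show ?thesis using eq_bad[OF True] s(1) by (auto simp: bad1_def)
    next
      case False
      then show ?thesis using f that by (simp add: \<gamma>0 nz_flow_def)
    qed
    have f1: "nz_flow E t h f1"
      unfolding f1_def by (rule nz_flow_add_zmul[OF f circC nz1])
    have nz2: "f1 e + zmul (\<chi> e) c \<noteq> 0" if "e \<in> E" for e
    proof (cases "e \<in> K")
      case True
      show ?thesis
      proof (cases "\<tau> e = 0")
        case True
        then show ?thesis using \<chi>K[OF \<open>e \<in> K\<close>] nz1[OF that] by (simp add: f1_def)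
      next
        case False
        then have "s \<noteq> - zmul (\<gamma>\<^sub>C e) (f e + zmul (\<tau> e) c)"
          using s(2) by (auto simp: bad2_def)
        then have "f e + zmul (\<tau> e) c + zmul (\<gamma>\<^sub>C e) s \<noteq> 0"
          using eq_bad[OF \<open>e \<in> K\<close>] by blast
        then show ?thesis using \<chi>K[OF \<open>e \<in> K\<close>] by (simp add: f1_def algebra_simps)
      qed
    next
      case False
      then show ?thesis using nz[of e] that by (simp add: f1_def \<gamma>0 \<chi>E)
    qed
    show "\<exists>g. nz_flow E t h g \<and> (cycle_step E t h)\<^sup>*\<^sup>* f g \<and> (\<forall>e\<in>E - K. g e = f e + zmul (\<gamma> e) c)"
    proof (intro exI conjI ballI)
      show "nz_flow E t h (\<lambda>e. f1 e + zmul (\<chi> e) c)"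
        by (rule nz_flow_add_zmul[OF f1 \<chi> nz2])
      have "(cycle_step E t h)\<^sup>*\<^sup>* f f1"
        unfolding f1_def
        by (rule unit_circulation_steps[OF finE f circC signed_cycle_unit[OF C] nz1])
      also have "(cycle_step E t h)\<^sup>*\<^sup>* f1 (\<lambda>e. f1 e + zmul (\<chi> e) c)"
        by (rule unit_circulation_steps[OF finE f1 \<chi> \<chi>1 nz2])
      finally show "(cycle_step E t h)\<^sup>*\<^sup>* f (\<lambda>e. f1 e + zmul (\<chi> e) c)" .
    qed (simp add: f1_def \<gamma>0 \<chi>E)
  next
    fix f g :: "'e \<Rightarrow> 'a"
    assume f: "nz_flow E t h f" and g: "nz_flow E t h g" and eq: "\<And>e. e \<notin> K \<Longrightarrow> f e = g e"
    have "circulation E t h (\<lambda>e. g e - f e)"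
      using f g by (intro circulation_diff) (auto simp: nz_flow_def)
    then obtain c where c: "\<And>e. g e - f e = zmul (\<gamma>\<^sub>C e) c"
      using circulation_on_signed_cycle[OF C finE, of "\<lambda>e. g e - f e"] eq by (auto simp: K_def)
    have "g = (\<lambda>e. f e + zmul (\<gamma>\<^sub>C e) c)"
      by (simp add: c[symmetric])
    then have "cycle_step E t h f g"
      using f g C unfolding cycle_step_def by blast
    then show "(cycle_step E t h)\<^sup>*\<^sup>* f g" by blast
  qed
qed

text \<open>
  At a vertex \<open>w\<close> with exactly two arcs the values of a flow on these arcs agree up to sign, so the
  value on the contracted arc is recovered from the other one, together with its being nonzero.
\<close>

lemma connected_flows_if_series_arc_contracted:
  fixes A :: "'a::ab_group_add itself" and E :: "'e set" and t h :: "'e \<Rightarrow> 'v"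
  assumes finE: "finite E" and arcs_w: "{e \<in> E. t e = w \<or> h e = w} = {e1, e2}" and "e1 \<noteq> e2"
    and noloop: "t e1 \<noteq> h e1" "t e2 \<noteq> h e2"
    and conn: "connected_flows A (E - {e1})
      (merge {t e1, h e1} (t e1) t) (merge {t e1, h e1} (t e1) h)"
  shows "connected_flows A E t h"
proof -
  have e12: "e1 \<in> E" "e2 \<in> E" "t e1 = w \<or> h e1 = w" "t e2 = w \<or> h e2 = w"
    using arcs_w by blast+
  interpret contraction E "{e1}" t h "{t e1, h e1}" "t e1"
    using finE e12 by unfold_locales auto
  have series: "d e1 = 0 \<longleftrightarrow> d e2 = 0" if "circulation E t h d" for d :: "'e \<Rightarrow> 'a"
  proof -
    have "0 = boundary E t h d w" using that by (simp add: circulation_def)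
    also have "\<dots> = (\<Sum>e\<in>{e1, e2}. (if t e = w then d e else 0) - (if h e = w then d e else 0))"
      unfolding boundary_def using finE arcs_w by (intro sum.mono_neutral_right) auto
    finally show ?thesis
      using \<open>e1 \<noteq> e2\<close> noloop e12 by (auto split: if_splits)
  qed
  show ?thesis
  proof (rule connected_flows_if_contraction[OF conn])
    fix f :: "'e \<Rightarrow> 'a" and \<gamma> x y c
    assume f: "nz_flow E t h f" and \<gamma>1: "\<And>e. \<bar>\<gamma> e\<bar> \<le> 1"
      and \<gamma>out: "\<And>e. e \<notin> E - {e1} \<Longrightarrow> \<gamma> e = 0" and xy: "x \<in> {t e1, h e1}" "y \<in> {t e1, h e1}"
      and bd\<gamma>: "\<And>u. boundary E t h \<gamma> u = (if u = x then 1 else 0) - (if u = y then 1 else 0)"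
      and nz: "\<And>e. e \<in> E - {e1} \<Longrightarrow> f e + zmul (\<gamma> e) c \<noteq> 0"
    \<comment> \<open>traverse \<open>e1\<close> from \<open>y\<close> to \<open>x\<close>\<close>
    define \<sigma> :: int where "\<sigma> = (if x = y then 0 else if y = t e1 then 1 else - 1)"
    define \<chi> where "\<chi> e = \<gamma> e + (if e = e1 then \<sigma> else 0)" for e
    have "boundary E t h \<chi> u = 0" for u
      unfolding \<chi>_def boundary_add bd\<gamma> boundary_single[OF finE e12(1)]
      using xy noloop by (auto simp: \<sigma>_def)
    then have \<chi>: "circulation E t h \<chi>"
      using \<gamma>out e12 by (auto simp: circulation_def \<chi>_def)
    have \<chi>1: "\<bar>\<chi> e\<bar> \<le> 1" for e
      using \<gamma>1[of e] \<gamma>out[of e1] by (auto simp: \<chi>_def \<sigma>_def)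
    define g where "g e = f e + zmul (\<chi> e) c" for e
    have g: "circulation E t h g"
      unfolding g_def using f by (intro circulation_add circulation_zmul \<chi>) (simp add: nz_flow_def)
    have "g e \<noteq> 0" if "e \<in> E - {e1}" for e
      using nz[OF that] that by (simp add: g_def \<chi>_def)
    then have nz': "f e + zmul (\<chi> e) c \<noteq> 0" if "e \<in> E" for e
      using series[OF g] that e12(2) \<open>e1 \<noteq> e2\<close> unfolding g_def by blast
    show "\<exists>g. nz_flow E t h g \<and> (cycle_step E t h)\<^sup>*\<^sup>* f g \<and>
        (\<forall>e\<in>E - {e1}. g e = f e + zmul (\<gamma> e) c)"
      using nz_flow_add_zmul[OF f \<chi> nz'] unit_circulation_steps[OF finE f \<chi> \<chi>1 nz']
      by (intro exI[of _ "\<lambda>e. f e + zmul (\<chi> e) c"]) (simp add: \<chi>_def)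
  next
    fix f g :: "'e \<Rightarrow> 'a"
    assume f: "nz_flow E t h f" and g: "nz_flow E t h g" and eq: "\<And>e. e \<notin> {e1} \<Longrightarrow> f e = g e"
    have "circulation E t h (\<lambda>e. f e - g e)"
      using f g by (intro circulation_diff) (auto simp: nz_flow_def)
    from series[OF this] have "f e1 = g e1"
      using eq[of e2] \<open>e1 \<noteq> e2\<close> by simp
    then have "f = g" using eq by (metis ext singletonD)
    then show "(cycle_step E t h)\<^sup>*\<^sup>* f g" by simp
  qed
qed

section \<open>Degrees\<close>

definition deg :: "'e set \<Rightarrow> ('e \<Rightarrow> 'v) \<Rightarrow> ('e \<Rightarrow> 'v) \<Rightarrow> 'v \<Rightarrow> nat" where
  "deg E t h v = card {e \<in> E. t e = v} + card {e \<in> E. h e = v}"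

definition branch_vertices :: "'e set \<Rightarrow> ('e \<Rightarrow> 'v) \<Rightarrow> ('e \<Rightarrow> 'v) \<Rightarrow> 'v set" where
  "branch_vertices E t h = {v. 3 \<le> deg E t h v}"

lemma deg_eq_0: "deg E t h v = 0" if "v \<notin> t ` E \<union> h ` E"
proof -
  have "{e \<in> E. t e = v} = {}" "{e \<in> E. h e = v} = {}" using that by auto
  then show ?thesis by (simp only: deg_def card.empty)
qed

lemma card_arcs_at:
  assumes "finite E" and loopless: "\<And>e. e \<in> E \<Longrightarrow> t e \<noteq> h e"
  shows "card {e \<in> E. t e = u \<or> h e = u} = deg E t h u"
proof -
  have "{e \<in> E. t e = u \<or> h e = u} = {e \<in> E. t e = u} \<union> {e \<in> E. h e = u}" by auto
  moreover have "t e \<noteq> u" if "e \<in> E" "h e = u" for e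
    using loopless[OF that(1)] that(2) by simp
  then have "{e \<in> E. t e = u} \<inter> {e \<in> E. h e = u} = {}" by blast
  ultimately show ?thesis
    unfolding deg_def using \<open>finite E\<close> by (simp add: card_Un_disjoint)
qed

lemma finite_branch_vertices:
  assumes "finite E"
  shows "finite (branch_vertices E t h)"
proof (rule finite_subset)
  show "branch_vertices E t h \<subseteq> t ` E \<union> h ` E"
    using deg_eq_0[of _ t E h] by (force simp: branch_vertices_def)
qed (use assms in simp)

context contraction
begin

lemma deg_contract_outside: "deg (E - K) t' h' v = deg E t h v" if "v \<notin> X"
proof -
  have "{e \<in> E - K. t' e = v} = {e \<in> E. t e = v}" "{e \<in> E - K. h' e = v} = {e \<in> E. h e = v}"
    using that KX x0 by (auto simp: merge_def)
  then show ?thesis by (simp add: deg_def)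
qed

lemma deg_contract_inside: "deg (E - K) t' h' v = 0" if "v \<in> X" "v \<noteq> x0"
  using that by (intro deg_eq_0) (auto simp: merge_def)

lemma deg_contracted_vertex:
  "deg (E - K) t' h' x0 + 2 * card K = (\<Sum>x\<in>X. deg E t h x)"
proof -
  have fibres: "(\<Sum>x\<in>X. card {e \<in> E. p e = x}) = card {e \<in> E - K. merge X x0 p e = x0} + card K"
    if "\<And>e. e \<in> K \<Longrightarrow> p e \<in> X" for p :: "'e \<Rightarrow> 'v"
  proof -
    have "(\<Sum>x\<in>X. card {e \<in> E. p e = x}) = card (\<Union>x\<in>X. {e \<in> E. p e = x})"
      using finX finE by (intro card_UN_disjoint[symmetric]) auto
    also have "(\<Union>x\<in>X. {e \<in> E. p e = x}) = {e \<in> E - K. merge X x0 p e = x0} \<union> K"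
      using that KE x0 by (auto simp: merge_def)
    also have "card \<dots> = card {e \<in> E - K. merge X x0 p e = x0} + card K"
      using finE KE by (intro card_Un_disjoint) (auto intro: rev_finite_subset)
    finally show ?thesis .
  qed
  show ?thesis
    unfolding deg_def sum.distrib using fibres[of t] fibres[of h] KX by simp
qed

text \<open>
  The degree of the new vertex is the sum of the old degrees less two for each arc of \<open>K\<close>. If all
  old degrees are at most two, it is at most \<open>2 * card X - 2 * card K \<le> 2\<close>, so a new vertex of
  degree at least three always replaces an old one.
\<close>

lemma card_branch_vertices_contract:
  assumes "card X \<le> card K + 1"
  shows "card (branch_vertices (E - K) t' h') \<le> card (branch_vertices E t h)"
proof -
  let ?B = "branch_vertices E t h" and ?B' = "branch_vertices (E - K) t' h'"
  have fin: "finite ?B" using finE by (rule finite_branch_vertices)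
  have sub: "?B' \<subseteq> insert x0 (?B - X)"
    using deg_contract_outside deg_contract_inside by (force simp: branch_vertices_def)
  show ?thesis
  proof (cases "x0 \<in> ?B'")
    case False
    then have "?B' \<subseteq> ?B" using sub by blast
    then show ?thesis using fin by (rule card_mono[rotated])
  next
    case True
    have "\<exists>x\<in>X. x \<in> ?B"
    proof (rule ccontr)
      assume "\<not> ?thesis"
      then have "deg E t h x \<le> 2" if "x \<in> X" for x using that by (auto simp: branch_vertices_def)
      then have "(\<Sum>x\<in>X. deg E t h x) \<le> 2 * card X"
        using sum_bounded_above[of X "deg E t h" 2] by simp
      then show False
        using True assms deg_contracted_vertex by (simp add: branch_vertices_def)
    qed
    then obtain x where x: "x \<in> X" "x \<in> ?B" by blast
    have "card ?B' \<le> card (insert x0 (?B - X))" using fin by (intro card_mono sub) auto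
    also have "\<dots> \<le> Suc (card (?B - X))" using fin by (simp add: card_insert_if)
    also have "\<dots> \<le> Suc (card (?B - {x}))"
      using x fin by (intro Suc_le_mono[THEN iffD2] card_mono) auto
    also have "\<dots> = card ?B" using fin x(2) by (rule card_Suc_Diff1)
    finally show ?thesis .
  qed
qed

end

section \<open>Short cycles\<close>

text \<open>
  \<open>path_chain E t h v0 k c u X\<close>: \<open>c\<close> is the chain, with boundary \<open>u - v0\<close>, of a path of length
  \<open>k\<close> from \<open>v0\<close> to \<open>u\<close> with vertex set \<open>X\<close>.
\<close>

inductive path_chain ::
    "'e set \<Rightarrow> ('e \<Rightarrow> 'v) \<Rightarrow> ('e \<Rightarrow> 'v) \<Rightarrow> 'v \<Rightarrow> nat \<Rightarrow> ('e \<Rightarrow> int) \<Rightarrow> 'v \<Rightarrow> 'v set \<Rightarrow> bool"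
  for E t h v0 where
  start: "path_chain E t h v0 0 (\<lambda>_. 0) v0 {v0}"
| extend: "path_chain E t h v0 k c u X \<Longrightarrow> e \<in> E \<Longrightarrow> {t e, h e} = {u, w} \<Longrightarrow> w \<notin> X \<Longrightarrow>
    path_chain E t h v0 (Suc k) (c(e := if t e = w then 1 else - 1)) w (insert w X)"

lemma boundary_extend:
  fixes c :: "'e \<Rightarrow> int"
  assumes "finite E" "e \<in> E" "c e = 0" "{t e, h e} = {u, w}" "u \<noteq> w"
  shows "boundary E t h (c(e := if t e = w then 1 else - 1)) z =
    boundary E t h c z + (if z = w then 1 else 0) - (if z = u then 1 else 0)"
proof -
  have "c(e := if t e = w then 1 else - 1) =
      (\<lambda>x. c x + (if x = e then if t e = w then 1 else - 1 else 0))"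
    using assms(3) by auto
  then show ?thesis
    using assms(4,5)
    by (simp add: boundary_add boundary_single[OF assms(1,2)] doubleton_eq_iff) auto
qed

text \<open>
  Integer circulations stand in for cycles here: two different short paths with the same ends
  differ by a nonzero circulation with small support, whether or not they share arcs.
\<close>

locale large_girth =
  fixes E :: "'e set" and t h :: "'e \<Rightarrow> 'v" and r :: nat and v0 :: 'v
  assumes finE: "finite E"
    and loopless: "\<And>e. e \<in> E \<Longrightarrow> t e \<noteq> h e"
    and deg_v0: "3 \<le> deg E t h v0"
    and deg_ends: "\<And>e. e \<in> E \<Longrightarrow> 3 \<le> deg E t h (t e) \<and> 3 \<le> deg E t h (h e)"
    and no_short: "\<And>\<chi> :: 'e \<Rightarrow> int. circulation E t h \<chi> \<Longrightarrow> card {e. \<chi> e \<noteq> 0} \<le> 2 * r \<Longrightarrow> \<chi> = (\<lambda>_. 0)"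
begin

abbreviation "path \<equiv> path_chain E t h v0"


lemma path_facts:
  assumes "path k c u X"
  shows "v0 \<in> X" "u \<in> X" "3 \<le> deg E t h u"
    "\<And>x. c x \<noteq> 0 \<Longrightarrow> x \<in> E \<and> t x \<in> X \<and> h x \<in> X"
    "\<And>z. boundary E t h c z = (if z = u then 1 else 0) - (if z = v0 then 1 else 0)"
    "card {x. c x \<noteq> 0} = k"
proof -
  have "v0 \<in> X \<and> u \<in> X \<and> 3 \<le> deg E t h u \<and> (\<forall>x. c x \<noteq> 0 \<longrightarrow> x \<in> E \<and> t x \<in> X \<and> h x \<in> X) \<and>
    (\<forall>z. boundary E t h c z = (if z = u then 1 else 0) - (if z = v0 then 1 else 0)) \<and>
    card {x. c x \<noteq> 0} = k"
    using assms
  proof (induction rule: path_chain.induct)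
    case start
    then show ?case using deg_v0 by (simp add: boundary_0)
  next
    case (extend k c u X e w)
    then have ends: "t e = u \<and> h e = w \<or> t e = w \<and> h e = u" by (auto simp: doubleton_eq_iff)
    have "u \<noteq> w" using extend by auto
    have ce: "c e = 0" using extend ends by auto
    let ?c = "c(e := if t e = w then 1 else - 1)"
    have "boundary E t h ?c z = (if z = w then 1 else 0) - (if z = v0 then 1 else 0)" for z
      using boundary_extend[where t = t and h = h and c = c, OF finE extend.hyps(2) ce extend.hyps(3) \<open>u \<noteq> w\<close>, of z] extend.IH by auto
    moreover have "3 \<le> deg E t h w"
      using deg_ends[OF extend.hyps(2)] ends by auto
    moreover have "{x. ?c x \<noteq> 0} = insert e {x. c x \<noteq> 0}" by auto
    moreover have "finite {x. c x \<noteq> 0}"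
      using extend.IH by (intro finite_subset[OF _ finE]) auto
    moreover have "x \<in> E \<and> t x \<in> insert w X \<and> h x \<in> insert w X" if "?c x \<noteq> 0" for x
      using that extend ends by (cases "x = e") auto
    ultimately show ?case using extend.IH ce by (simp del: fun_upd_apply)
  qed
  then show "v0 \<in> X" "u \<in> X" "3 \<le> deg E t h u"
    "\<And>x. c x \<noteq> 0 \<Longrightarrow> x \<in> E \<and> t x \<in> X \<and> h x \<in> X"
    "\<And>z. boundary E t h c z = (if z = u then 1 else 0) - (if z = v0 then 1 else 0)"
    "card {x. c x \<noteq> 0} = k"
    by blast+
qed

lemma finite_path_support: "path k c u X \<Longrightarrow> finite {x. c x \<noteq> 0}"
  using path_facts(4) by (intro finite_subset[OF _ finE]) auto

lemma path_last_arc: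
  assumes "path k c u X"
  shows "card {x. c x \<noteq> 0 \<and> (t x = u \<or> h x = u)} \<le> min k 1"
  using assms
proof (cases rule: path_chain.cases)
  case (extend k' c' u' X' e)
  have "c' x = 0" if "t x = u \<or> h x = u" for x
    using path_facts(4)[OF extend(4), of x] extend(7) that by auto
  then have "{x. c x \<noteq> 0 \<and> (t x = u \<or> h x = u)} \<subseteq> {e}"
    using extend by auto
  then show ?thesis
    using card_mono[of "{e}"] extend by auto
qed simp

lemma subpath:
  assumes "path k c u X" "w \<in> X"
  shows "\<exists>c' :: 'e \<Rightarrow> int. (\<forall>x. c' x \<noteq> 0 \<longrightarrow> c x \<noteq> 0) \<and>
    (\<forall>z. boundary E t h c' z = (if z = w then 1 else 0) - (if z = v0 then 1 else 0))"
  using assms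
proof (induction arbitrary: w rule: path_chain.induct)
  case start
  then show ?case by (intro exI[of _ "\<lambda>_. 0"]) (simp add: boundary_0)
next
  case (extend k c u X e y)
  let ?c = "c(e := if t e = y then 1 else - 1)"
  show ?case
  proof (cases "w = y")
    case True
    have "path (Suc k) ?c y (insert y X)" using extend by (intro path_chain.extend)
    from path_facts(5)[OF this] show ?thesis unfolding True by blast
  next
    case False
    then have "w \<in> X" using extend.prems by simp
    then obtain c' :: "'e \<Rightarrow> int" where "\<forall>x. c' x \<noteq> 0 \<longrightarrow> c x \<noteq> 0"
      "\<forall>z. boundary E t h c' z = (if z = w then 1 else 0) - (if z = v0 then 1 else 0)"
      using extend.IH by blast
    then show ?thesis by (intro exI[of _ c']) auto
  qed
qed

text \<open>
  If the arc led back to a vertex of the path, it would close a cycle of length at most \<open>k + 1\<close>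
  with a part of the path.
\<close>

lemma path_extends:
  assumes p: "path k c u X" and k: "k < 2 * r" and e: "e \<in> E" "{t e, h e} = {u, w}" "c e = 0"
  shows "w \<notin> X"
proof
  assume "w \<in> X"
  then obtain c' :: "'e \<Rightarrow> int" where c': "\<And>x. c' x \<noteq> 0 \<Longrightarrow> c x \<noteq> 0"
      "\<And>z. boundary E t h c' z = (if z = w then 1 else 0) - (if z = v0 then 1 else 0)"
    using subpath[OF p] by blast
  have "u \<noteq> w" using loopless[OF e(1)] e(2) by (auto simp: doubleton_eq_iff)
  let ?c = "c(e := if t e = w then 1 else - 1)"
  define \<chi> where "\<chi> x = ?c x - c' x" for x
  have "boundary E t h \<chi> z = 0" for z
    unfolding \<chi>_def boundary_diff c'(2) boundary_extend[where t = t and h = h and c = c, OF finE e(1,3,2) \<open>u \<noteq> w\<close>] path_facts(5)[OF p]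
    by simp
  moreover have supp: "x = e \<or> c x \<noteq> 0" if "\<chi> x \<noteq> 0" for x
    using that c'(1)[of x] by (auto simp: \<chi>_def split: if_splits)
  ultimately have "circulation E t h \<chi>"
    using path_facts(4)[OF p] e(1) by (force simp: circulation_def)
  moreover have "card {x. \<chi> x \<noteq> 0} \<le> card (insert e {x. c x \<noteq> 0})"
    using supp finite_path_support[OF p] by (intro card_mono) auto
  then have "card {x. \<chi> x \<noteq> 0} \<le> 2 * r"
    using k path_facts(6)[OF p] finite_path_support[OF p] e(3) by simp
  ultimately have "\<chi> = (\<lambda>_. 0)" by (rule no_short)
  then have "\<chi> e = 0" by simp
  moreover have "c' e = 0" using c'(1) e(3) by blast
  ultimately show False by (simp add: \<chi>_def split: if_splits)
qed

lemma path_unique: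
  assumes "path k c u X" "path k' c' u X'" "k \<le> r" "k' \<le> r"
  shows "c = c'"
proof -
  have "circulation E t h (\<lambda>x. c x - c' x)"
    using path_facts(4,5)[OF assms(1)] path_facts(4,5)[OF assms(2)]
    by (force simp: circulation_def boundary_diff)
  moreover have "card {x. c x - c' x \<noteq> 0} \<le> card ({x. c x \<noteq> 0} \<union> {x. c' x \<noteq> 0})"
    using assms(1,2) by (intro card_mono) (auto intro: finite_path_support)
  then have "card {x. c x - c' x \<noteq> 0} \<le> 2 * r"
    using card_Un_le[of "{x. c x \<noteq> 0}" "{x. c' x \<noteq> 0}"] path_facts(6)[OF assms(1)]
      path_facts(6)[OF assms(2)] assms(3,4) by linarith
  ultimately have "(\<lambda>x. c x - c' x) = (\<lambda>_. 0)" by (rule no_short)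
  then show ?thesis by (simp add: fun_eq_iff)
qed

definition sphere :: "nat \<Rightarrow> 'v set" where
  "sphere k = {u. \<exists>c X. path k c u X}"

lemma sphere_subset: "sphere k \<subseteq> branch_vertices E t h"
  using path_facts(3) by (auto simp: sphere_def branch_vertices_def)

lemma finite_sphere: "finite (sphere k)"
  using finite_subset[OF sphere_subset finite_branch_vertices[OF finE]] .

lemma sphere_disjoint: "sphere j \<inter> sphere k = {}" if "j \<le> r" "k \<le> r" "j \<noteq> k"
proof (rule ccontr)
  assume "\<not> ?thesis"
  then obtain u c X c' X' where p: "path j c u X" "path k c' u X'" by (auto simp: sphere_def)
  then have "c = c'" using path_unique that by blast
  then show False using path_facts(6) p \<open>j \<noteq> k\<close> by metis
qed

lemma sphere_0: "sphere 0 = {v0}"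
  by (auto simp: sphere_def intro: path_chain.start elim: path_chain.cases)

text \<open>
  Each vertex \<open>u\<close> of a sphere has at least two arcs besides the last arc of the path leading to it
  (and \<open>v0\<close> has three), each arc leads on to a new vertex, and the new vertex determines the arc,
  which is the last arc of the unique path to it.
\<close>

lemma card_sphere_Suc:
  assumes "k < r"
  shows "(3 - min k 1) * card (sphere k) \<le> card (sphere (Suc k))"
proof -
  have "\<exists>c X. path k c u X" if "u \<in> sphere k" for u using that by (simp add: sphere_def)
  then obtain c X where cX: "\<And>u. u \<in> sphere k \<Longrightarrow> path k (c u) u (X u)" by metis
  define F where "F u = {e \<in> E. (t e = u \<or> h e = u) \<and> c u e = 0}" for u
  define other where "other = (\<lambda>(u, e). if t e = u then h e else t e)"
  have finF: "finite (F u)" for u using finE by (simp add: F_def)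
  have cardF: "3 - min k 1 \<le> card (F u)" if u: "u \<in> sphere k" for u
  proof -
    note p = cX[OF u]
    let ?used = "{x. c u x \<noteq> 0 \<and> (t x = u \<or> h x = u)}"
    have "{e \<in> E. t e = u \<or> h e = u} = F u \<union> ?used"
      using path_facts(4)[OF p] by (auto simp: F_def)
    then have "deg E t h u \<le> card (F u) + card ?used"
      using card_Un_le[of "F u" ?used] by (simp add: card_arcs_at[OF finE loopless, symmetric])
    then show ?thesis using path_facts(3)[OF p] path_last_arc[OF p] by linarith
  qed
  have step: "path (Suc k) ((c u)(e := if t e = w then 1 else - 1)) w (insert w (X u))"
      "w \<notin> X u" "{t e, h e} = {u, w}"
    if u: "u \<in> sphere k" and e: "e \<in> F u" and w: "w = other (u, e)" for u e w
  proof -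
    have e': "e \<in> E" "c u e = 0" using e by (auto simp: F_def)
    show ends: "{t e, h e} = {u, w}" using e by (auto simp: w other_def F_def)
    show "w \<notin> X u" using path_extends[OF cX[OF u] _ e'(1) ends e'(2)] assms by simp
    then show "path (Suc k) ((c u)(e := if t e = w then 1 else - 1)) w (insert w (X u))"
      by (rule path_chain.extend[OF cX[OF u] e'(1) ends])
  qed
  have "inj_on other (Sigma (sphere k) F)"
  proof (rule inj_onI, clarify)
    fix u e u' e'
    assume u: "u \<in> sphere k" "e \<in> F u" and u': "u' \<in> sphere k" "e' \<in> F u'"
      and eq: "other (u, e) = other (u', e')"
    define w where "w = other (u, e)"
    have w': "w = other (u', e')" by (simp add: w_def eq)
    note s = step[OF u w_def] and s' = step[OF u' w']
    have "(c u)(e := if t e = w then 1 else - 1) = (c u')(e' := if t e' = w then 1 else - 1)"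
      by (rule path_unique[OF s(1) s'(1)]) (use assms in auto)
    from fun_cong[OF this, of e'] have "e' = e \<or> c u e' \<noteq> 0" by (auto split: if_splits)
    moreover have "c u e' = 0"
      using path_facts(4)[OF cX[OF u(1)], of e'] s(2) s'(3) by (auto simp: doubleton_eq_iff)
    ultimately have "e' = e" by blast
    moreover have "u' = u" using s(3) s'(3) \<open>e' = e\<close> by (auto simp: doubleton_eq_iff)
    ultimately show "u = u' \<and> e = e'" by simp
  qed
  moreover have "other ` Sigma (sphere k) F \<subseteq> sphere (Suc k)"
    using step(1) by (fastforce simp: sphere_def)
  ultimately have "card (Sigma (sphere k) F) \<le> card (sphere (Suc k))"
    by (intro card_inj_on_le finite_sphere)
  moreover have "(3 - min k 1) * card (sphere k) \<le> (\<Sum>u\<in>sphere k. card (F u))"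
    using sum_bounded_below[of "sphere k" "3 - min k 1" "\<lambda>u. card (F u)"] cardF
    by (simp add: mult.commute)
  ultimately show ?thesis using finite_sphere finF by (simp add: card_SigmaI)
qed

lemma card_sphere: "k < r \<Longrightarrow> 3 * 2 ^ k \<le> card (sphere (Suc k))"
proof (induction k)
  case 0
  then show ?case using card_sphere_Suc[of 0] by (simp add: sphere_0)
next
  case (Suc k)
  then show ?case using card_sphere_Suc[of "Suc k"] by simp
qed

text \<open>
  The spheres of radius up to \<open>r\<close> are disjoint, and their sizes are at least
  \<open>1, 3, 3 * 2, \<dots>, 3 * 2 ^ (r - 1)\<close>, with sum \<open>3 * 2 ^ r - 2\<close>.
\<close>

lemma moore_bound: "3 * 2 ^ r \<le> card (branch_vertices E t h) + 2"
proof -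
  have "m \<le> r \<Longrightarrow> 3 * 2 ^ m \<le> (\<Sum>k\<le>m. card (sphere k)) + 2" for m
  proof (induction m)
    case 0
    then show ?case by (simp add: sphere_0)
  next
    case (Suc m)
    then show ?case using card_sphere[of m] by simp
  qed
  then have "3 * 2 ^ r \<le> (\<Sum>k\<le>r. card (sphere k)) + 2" by simp
  also have "(\<Sum>k\<le>r. card (sphere k)) = card (\<Union>k\<le>r. sphere k)"
    using finite_sphere sphere_disjoint by (intro card_UN_disjoint[symmetric]) auto
  also have "\<dots> \<le> card (branch_vertices E t h)"
    using sphere_subset by (intro card_mono finite_branch_vertices finE) auto
  finally show ?thesis by simp
qed

end

lemma short_signed_cycle_exists:
  assumes finE: "finite E" and "E \<noteq> {}" and loopless: "\<And>e. e \<in> E \<Longrightarrow> t e \<noteq> h e"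
    and deg: "\<And>e. e \<in> E \<Longrightarrow> 3 \<le> deg E t h (t e) \<and> 3 \<le> deg E t h (h e)"
    and small: "card (branch_vertices E t h) + 2 < 3 * 2 ^ r"
  obtains \<gamma> l v a where "signed_cycle E t h \<gamma> l v a" "l \<le> 2 * r"
proof (rule ccontr)
  assume none: "\<not> thesis"
  note found = that
  obtain e0 where e0: "e0 \<in> E" using \<open>E \<noteq> {}\<close> by blast
  have "\<chi> = (\<lambda>_. 0)" if \<chi>: "circulation E t h \<chi>" "card {e. \<chi> e \<noteq> 0} \<le> 2 * r" for \<chi> :: "_ \<Rightarrow> int"
  proof (rule ccontr)
    assume "\<chi> \<noteq> (\<lambda>_. 0)"
    then obtain e where "\<chi> e \<noteq> 0" by auto
    then obtain \<gamma> l v a where C: "signed_cycle E t h \<gamma> l v a"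
      and conf: "\<And>e. \<gamma> e \<noteq> 0 \<Longrightarrow> \<gamma> e = sgn (\<chi> e)"
      using conformal_signed_cycle_exists[OF finE \<chi>(1)] by metis
    have "finite {e. \<chi> e \<noteq> 0}"
      using \<chi>(1) by (intro finite_subset[OF _ finE]) (auto simp: circulation_def)
    moreover have "{e. \<gamma> e \<noteq> 0} \<subseteq> {e. \<chi> e \<noteq> 0}"
      using conf by force
    ultimately have "l \<le> card {e. \<chi> e \<noteq> 0}"
      using signed_cycle_card[OF C] card_mono by metis
    then show False using none found[OF C] \<chi>(2) by simp
  qed
  then interpret large_girth E t h r "t e0"
    using finE loopless deg e0 by unfold_locales auto
  show False using moore_bound small by simp
qed

section \<open>Induction by contraction\<close>

lemma nz_flow_no_leaf:
  assumes f: "nz_flow E t h f" and "finite E" "e \<in> E" and noloop: "t e \<noteq> h e"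
  shows "{x \<in> E. t x = w \<or> h x = w} \<noteq> {e}"
proof
  assume eq: "{x \<in> E. t x = w \<or> h x = w} = {e}"
  have "0 = boundary E t h f w" using f by (simp add: nz_flow_def circulation_def)
  also have "\<dots> = boundary {e} t h f w"
    unfolding boundary_def using assms(2,3) eq by (intro sum.mono_neutral_right) auto
  finally have "f e = 0"
    using eq noloop by (auto simp: boundary_def split: if_splits)
  then show False using f \<open>e \<in> E\<close> by (simp add: nz_flow_def)
qed

text \<open>
  An arc at a vertex of degree two, a loop, or a cycle of length at most \<open>2 * r\<close> can always be
  contracted next: the number of vertices of degree at least three never grows, so that short
  cycles exist all the way down.
\<close>

lemma connected_flows_if_few_branch_vertices:
  fixes A :: "'a::{ab_group_add, finite} itself" and t h :: "'e \<Rightarrow> 'v"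
  assumes "finite E" and "card (branch_vertices E t h) + 2 < 3 * 2 ^ r"
    and card_A: "1 < CARD('a)" "3 * r < CARD('a)"
  shows "connected_flows A E t h"
  using assms(1,2)
proof (induction "card E" arbitrary: E t h rule: less_induct)
  case less
  note finE = less.prems(1)
  \<comment> \<open>the induction hypothesis for all contractions to which the bound on branch vertices passes\<close>
  have IH: "connected_flows A (E - K) (merge X x0 t) (merge X x0 h)"
    if "contraction E K t h X x0" "card X \<le> card K + 1" "K \<noteq> {}" for K X x0
  proof (rule less.hyps)
    interpret contraction E K t h X x0 by fact
    show "card (E - K) < card E"
      using that(3) KE by (intro psubset_card_mono finE) auto
    show "card (branch_vertices (E - K) (merge X x0 t) (merge X x0 h)) + 2 < 3 * 2 ^ r"
      using card_branch_vertices_contract[OF that(2)] less.prems(2) by linarith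
  qed (use finE in simp)
  have short_cycle: ?case if C: "signed_cycle E t h \<gamma> l v a" and l: "l + l div 2 < CARD('a)" for \<gamma> l v a
  proof (rule connected_flows_if_short_cycle_contracted[OF finE C l], rule IH)
    show "contraction E (a ` {..<l}) t h (v ` {..<l}) (v 0)"
      by (rule contraction_signed_cycle[OF finE C])
    show "card (v ` {..<l}) \<le> card (a ` {..<l}) + 1"
      using signed_cycle_facts(2)[OF C] signed_cycle_inj[OF C] by (simp add: card_image)
    show "a ` {..<l} \<noteq> {}" using signed_cycle_facts(1)[OF C] by auto
  qed
  consider (loop) e where "e \<in> E" "t e = h e"
    | (no_flow) "\<nexists>f :: 'e \<Rightarrow> 'a. nz_flow E t h f"
    | (empty) "E = {}"
    | (series) e w and f :: "'e \<Rightarrow> 'a" where "\<And>e. e \<in> E \<Longrightarrow> t e \<noteq> h e" "nz_flow E t h f"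
        "e \<in> E" "t e = w \<or> h e = w" "deg E t h w < 3"
    | (cubic) "\<And>e. e \<in> E \<Longrightarrow> t e \<noteq> h e" "E \<noteq> {}"
        "\<And>e. e \<in> E \<Longrightarrow> 3 \<le> deg E t h (t e) \<and> 3 \<le> deg E t h (h e)"
    by (metis leI)
  then show ?case
  proof cases
    case loop
    have "signed_cycle E t h (\<lambda>x. if x = e then 1 else 0) 1 (\<lambda>_. t e) (\<lambda>_. e)"
      using loop by (auto simp: signed_cycle_def src_def dst_def inj_on_def)
    then show ?thesis using card_A by (intro short_cycle) auto
  next
    case no_flow
    then show ?thesis by (auto simp: connected_flows_def)
  next
    case empty
    have "f = g" if "nz_flow E t h f" "nz_flow E t h g" for f g :: "'e \<Rightarrow> 'a"
      using that empty by (auto simp: nz_flow_def circulation_def)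
    then show ?thesis by (auto simp: connected_flows_def)
  next
    case series
    let ?W = "{x \<in> E. t x = w \<or> h x = w}"
    have "e \<in> ?W" using series by simp
    moreover have "?W \<noteq> {e}"
      using nz_flow_no_leaf[OF series(2) finE series(3) series(1)[OF series(3)]] .
    moreover have "card ?W < 3" using card_arcs_at[OF finE series(1)] series(5) by simp
    moreover have "finite ?W" using finE by simp
    ultimately obtain e' where e': "?W = {e, e'}" "e \<noteq> e'"
    proof -
      from \<open>e \<in> ?W\<close> \<open>?W \<noteq> {e}\<close> obtain e' where e': "e' \<in> ?W" "e' \<noteq> e" by blast
      have "?W = {e, e'}"
        using e' \<open>e \<in> ?W\<close> \<open>card ?W < 3\<close>
        by (intro card_seteq[symmetric] \<open>finite ?W\<close>) auto
      with e' show thesis using that by metis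
    qed
    have "e' \<in> E" using e'(1) by blast
    show ?thesis
    proof (rule connected_flows_if_series_arc_contracted[OF finE e' series(1) series(1), OF series(3) \<open>e' \<in> E\<close>],
        rule IH)
      show "contraction E {e} t h {t e, h e} (t e)"
        using finE series by unfold_locales auto
    qed (use series in auto)
  next
    case cubic
    obtain \<gamma> l v a where C: "signed_cycle E t h \<gamma> l v a" "l \<le> 2 * r"
      using short_signed_cycle_exists[OF finE cubic(2,1,3) less.prems(2)] by blast
    from C(2) have "l + l div 2 \<le> 3 * r" by linarith
    then show ?thesis using C(1) card_A(2) by (intro short_cycle) auto
  qed
qed

text \<open>
  For the least \<open>r\<close> with \<open>m + 2 < 3 * 2 ^ r\<close> one has \<open>m + 2 \<ge> 3 * 2 ^ (r - 1)\<close> unless \<open>r = 0\<close>, and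
  \<open>3 ^ 3 \<ge> 2 ^ 4\<close> turns the cube of this into \<open>(m + 2) ^ 3 \<ge> 2 ^ (3 * r + 1)\<close>.
\<close>

lemma log_bound:
  fixes c m :: nat and x :: real
  assumes c: "int c \<ge> \<lfloor>3 * log 2 (x + 2)\<rfloor>" and mx: "real m \<le> x"
  obtains r where "m + 2 < 3 * 2 ^ r" "3 * r < c" "1 < c"
proof -
  have le_c: "k \<le> c" if "2 ^ k \<le> (x + 2) ^ 3" for k
  proof -
    have "real k = log 2 (2 ^ k)" by simp
    also have "\<dots> \<le> log 2 ((x + 2) ^ 3)" using that mx by (subst log_le_cancel_iff) auto
    also have "\<dots> = 3 * log 2 (x + 2)" using mx by (subst log_nat_power) auto
    finally have "int k \<le> \<lfloor>3 * log 2 (x + 2)\<rfloor>" by (simp add: le_floor_iff)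
    then show ?thesis using c by linarith
  qed
  have "(2::real) ^ 3 \<le> (x + 2) ^ 3" using mx by (intro power_mono) auto
  then have c3: "3 \<le> c" by (rule le_c)
  have "m + 2 < 3 * 2 ^ (m + 2)" using less_exp[of "m + 2"] by linarith
  then have ex: "\<exists>r. m + 2 < 3 * 2 ^ r" ..
  define r where "r = (LEAST r. m + 2 < 3 * 2 ^ r)"
  have r: "m + 2 < 3 * 2 ^ r" unfolding r_def using ex by (rule LeastI_ex)
  have "3 * r < c"
  proof (cases r)
    case 0
    then show ?thesis using c3 by simp
  next
    case (Suc q)
    then have "\<not> m + 2 < 3 * 2 ^ q"
      using not_less_Least[of q "\<lambda>r. m + 2 < 3 * 2 ^ r"] by (simp add: r_def)
    then have "3 * 2 ^ q \<le> m + 2" by simp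
    then have "real (3 * 2 ^ q) \<le> real (m + 2)" by (simp only: of_nat_le_iff)
    then have "3 * 2 ^ q \<le> x + 2" using mx by simp
    then have "(3 * 2 ^ q) ^ 3 \<le> (x + 2) ^ 3" by (intro power_mono) auto
    moreover have "(2::real) ^ (3 * r + 1) \<le> (3 * 2 ^ q) ^ 3"
      by (simp add: Suc power_mult_distrib power_mult[symmetric] power_add mult.commute)
    ultimately have "3 * r + 1 \<le> c" by (intro le_c) linarith
    then show ?thesis by simp
  qed
  with r c3 that show thesis by auto
qed

section \<open>Cycles as subgraphs\<close>

context
  fixes G :: "('v, 'e) pre_digraph"
  assumes G: "fin_digraph G"
begin

interpretation fin_digraph G by (rule G)

abbreviation "bd \<equiv> boundary (arcs G) (tail G) (head G)"

lemma boundary_arcs: "bd f v = (\<Sum>e\<in>out_arcs G v. f e) - (\<Sum>e\<in>in_arcs G v. f e)"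
  unfolding boundary_def sum_subtractf out_arcs_def in_arcs_def
  by (simp add: sum.inter_filter)

lemma nz_flow_of_flow:
  assumes "f \<in> flows G"
  shows "nz_flow (arcs G) (tail G) (head G) (\<lambda>e. if e \<in> arcs G then f e else 0)"
proof -
  let ?f = "\<lambda>e. if e \<in> arcs G then f e else 0"
  have eq: "bd ?f v = bd f v" for v
    unfolding boundary_def by (intro sum.cong) auto
  have "bd f v = 0" for v
  proof (cases "v \<in> verts G")
    case True
    then show ?thesis using assms by (simp add: boundary_arcs flows_def)
  next
    case False
    then have "out_arcs G v = {}" "in_arcs G v = {}" by auto
    then show ?thesis by (simp add: boundary_arcs)
  qed
  then show ?thesis using assms by (auto simp: nz_flow_def circulation_def eq flows_def)
qed

lemma flow_of_nz_flow:
  assumes "nz_flow (arcs G) (tail G) (head G) f"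
  shows "restrict f (arcs G) \<in> flows G"
proof -
  have "bd (restrict f (arcs G)) v = bd f v" for v
    unfolding boundary_def by (intro sum.cong) auto
  then show ?thesis
    using assms by (auto simp: flows_def boundary_arcs[symmetric] nz_flow_def circulation_def)
qed

lemma deg_eq_degree: "deg (arcs H) (tail H) (head H) v = degree H v"
  by (simp add: deg_def degree_def in_degree_def out_degree_def in_arcs_def out_arcs_def)

lemma card_branch_vertices_le:
  "card (branch_vertices (arcs G) (tail G) (head G)) + card {v \<in> verts G. degree G v = 2}
    \<le> card (verts G)"
proof -
  let ?B = "branch_vertices (arcs G) (tail G) (head G)" and ?T = "{v \<in> verts G. degree G v = 2}"
  have "?B \<subseteq> verts G"
  proof
    fix v assume "v \<in> ?B"
    then have "deg (arcs G) (tail G) (head G) v \<noteq> 0" by (simp add: branch_vertices_def)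
    then have "v \<in> tail G ` arcs G \<union> head G ` arcs G" using deg_eq_0 by metis
    then show "v \<in> verts G" by auto
  qed
  then have "card (?B \<union> ?T) \<le> card (verts G)" by (intro card_mono) auto
  moreover have "?B \<inter> ?T = {}" by (auto simp: branch_vertices_def deg_eq_degree)
  then have "card (?B \<union> ?T) = card ?B + card ?T"
    by (intro card_Un_disjoint finite_branch_vertices) auto
  ultimately show ?thesis by simp
qed

lemma cycle_in_of_signed_cycle:
  assumes C: "signed_cycle (arcs G) (tail G) (head G) \<gamma> l v a"
  shows "cycle_in G \<lparr>verts = v ` {..<l}, arcs = a ` {..<l}, tail = tail G, head = head G\<rparr>"
proof -
  note cyc = signed_cycle_facts[OF C]
  let ?C = "\<lparr>verts = v ` {..<l}, arcs = a ` {..<l}, tail = tail G, head = head G\<rparr>"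
  interpret contraction "arcs G" "a ` {..<l}" "tail G" "head G" "v ` {..<l}" "v 0"
    by (rule contraction_signed_cycle[OF _ C]) simp
  have wf: "wf_digraph ?C" using KX by unfold_locales auto
  have ends: "{tail G (a i), head G (a i)} = {v i, v (Suc i)}" if "i < l" for i
    using cyc(6,7)[OF that] by (auto simp: src_def dst_def split: if_splits)
  have "v i \<in> verts G" if "i < l" for i
    using ends[OF that] cyc(4)[OF that] by (metis doubleton_eq_iff head_in_verts tail_in_verts)
  then have sub: "subgraph ?C G"
    using wf cyc(4) wf_digraph_axioms by (auto simp: subgraph_def compatible_def)
  interpret S: pair_wf_digraph "mk_symmetric ?C"
    using wf by (rule wf_digraph.wellformed_mk_symmetric)
  have adj: "(v i, v (Suc i)) \<in> parcs (mk_symmetric ?C)" "(v (Suc i), v i) \<in> parcs (mk_symmetric ?C)"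
    if "i < l" for i
    using ends[OF that] that unfolding parcs_mk_symmetric by (auto simp: doubleton_eq_iff intro!: bexI[of _ i])
  have reach: "v 0 \<rightarrow>\<^sup>*\<^bsub>with_proj (mk_symmetric ?C)\<^esub> v i \<and> v i \<rightarrow>\<^sup>*\<^bsub>with_proj (mk_symmetric ?C)\<^esub> v 0"
    if "i < l" for i
    using that
  proof (induction i)
    case 0
    then show ?case by (auto intro!: S.reachable_refl)
  next
    case (Suc i)
    then have i: "i < l" by simp
    note IH = Suc.IH[OF i]
    show ?case
      using S.reachable_adj_trans[OF conjunct1[OF IH] adj(1)[OF i]]
        S.adj_reachable_trans[OF adj(2)[OF i] conjunct2[OF IH]] by blast
  qed
  have conn: "Digraph_Component.connected ?C"
    unfolding connected_def
  proof (rule strongly_connectedI)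
    show "verts (with_proj (mk_symmetric ?C)) \<noteq> {}" using cyc(1) by auto
    fix x y assume "x \<in> verts (with_proj (mk_symmetric ?C))" "y \<in> verts (with_proj (mk_symmetric ?C))"
    then show "x \<rightarrow>\<^sup>*\<^bsub>with_proj (mk_symmetric ?C)\<^esub> y"
      using reach S.reachable_trans[of x "v 0" y] by auto
  qed
  have "degree ?C (v i) = 2" if "i < l" for i
  proof -
    let ?u = "v i"
    have "degree ?C ?u = (\<Sum>e\<in>a ` {..<l}. (if tail G e = ?u then 1 else 0) + (if head G e = ?u then 1 else 0))"
      by (simp add: degree_def in_degree_def out_degree_def in_arcs_def out_arcs_def sum.distrib
          card_eq_sum sum.inter_filter add.commute del: sum_constant One_nat_def)
    also have "\<dots> = (\<Sum>k<l. (if v k = ?u then 1 else 0) + (if v (Suc k) = ?u then 1 else 0))"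
      unfolding sum.reindex[OF signed_cycle_inj[OF C]] o_def
    proof (rule sum.cong)
      fix k assume "k \<in> {..<l}"
      then have "tail G (a k) = v k \<and> head G (a k) = v (Suc k) \<or>
          tail G (a k) = v (Suc k) \<and> head G (a k) = v k"
        using ends by (simp add: doubleton_eq_iff)
      then show "(if tail G (a k) = ?u then 1 else 0) + (if head G (a k) = ?u then 1 else 0) =
          (if v k = ?u then 1 else 0) + (if v (Suc k) = ?u then 1 else (0::nat))"
        by auto
    qed simp
    \<comment> \<open>since \<open>v l = v 0\<close>, shifting the index by one does not change the sum\<close>
    also have "\<dots> = 2 * (\<Sum>k<l. if v k = ?u then 1 else 0)"
      using sum.lessThan_Suc_shift[of "\<lambda>k. if v k = ?u then 1 else (0::nat)" l] cyc(3)
      by (simp add: sum.distrib)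
    also have "(\<Sum>k<l. if v k = ?u then 1 else 0) = (\<Sum>k<l. if k = i then 1 else (0::nat))"
      using cyc(2) that by (intro sum.cong) (auto dest: inj_onD)
    finally show ?thesis using that by simp
  qed
  then show ?thesis using sub conn by (auto simp: cycle_in_def)
qed

lemma flow_adjacent_of_cycle_step:
  assumes "cycle_step (arcs G) (tail G) (head G) f g"
  shows "flow_adjacent G (restrict f (arcs G)) (restrict g (arcs G))"
proof -
  obtain \<gamma> l v a c where f: "nz_flow (arcs G) (tail G) (head G) f"
    and g: "nz_flow (arcs G) (tail G) (head G) g"
    and C: "signed_cycle (arcs G) (tail G) (head G) \<gamma> l v a" and eq: "g = (\<lambda>e. f e + zmul (\<gamma> e) c)"
    using assms unfolding cycle_step_def by blast
  have "\<gamma> e = 0" if "e \<notin> a ` {..<l}" for e using signed_cycle_facts(8)[OF C that] .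
  then show ?thesis
    unfolding flow_adjacent_def using flow_of_nz_flow[OF f] flow_of_nz_flow[OF g] cycle_in_of_signed_cycle[OF C]
    by (intro conjI exI[of _ "\<lparr>verts = v ` {..<l}, arcs = a ` {..<l}, tail = tail G, head = head G\<rparr>"])
      (auto simp: eq)
qed

lemma flow_connected_of_connected_flows:
  fixes A :: "'a::ab_group_add itself"
  assumes "connected_flows A (arcs G) (tail G) (head G)"
  shows "flow_connected A G"
  unfolding flow_connected_def flow_equivalent_def
proof (intro ballI)
  fix f g :: "'e \<Rightarrow> 'a"
  assume f: "f \<in> flows G" and g: "g \<in> flows G"
  let ?ext = "\<lambda>f e. if e \<in> arcs G then f e else 0"
  have restrict: "restrict (?ext f) (arcs G) = f" if "f \<in> flows G" for f :: "'e \<Rightarrow> 'a"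
    using that by (auto simp: flows_def PiE_def extensional_def restrict_def)
  have "(cycle_step (arcs G) (tail G) (head G))\<^sup>*\<^sup>* (?ext f) (?ext g)"
    using assms nz_flow_of_flow f g unfolding connected_flows_def by blast
  then have "(flow_adjacent G)\<^sup>*\<^sup>* (restrict (?ext f) (arcs G)) (restrict (?ext g) (arcs G))"
  proof (induction rule: rtranclp_induct)
    case (step y z)
    show ?case
      by (rule rtranclp.rtrancl_into_rtrancl[where r = "flow_adjacent G",
            OF step.IH flow_adjacent_of_cycle_step[OF step.hyps(2)]])
  qed (rule rtranclp.rtrancl_refl)
  then show "(flow_adjacent G)\<^sup>*\<^sup>* f g"
    by (simp only: restrict[OF f] restrict[OF g])
qed

end

theorem theorem5p6:
  fixes G :: "('v, 'e) pre_digraph"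
    and A :: "'a::{ab_group_add, finite} itself"
    and n n\<^sub>2 :: nat
  assumes "fin_digraph G"
    and "bridgeless G"
    and "card (verts G) = n"
    and "card {v \<in> verts G. degree G v = 2} = n\<^sub>2"
    and "int CARD('a) \<ge> \<lfloor>3 * log 2 (real n - real n\<^sub>2 + 2)\<rfloor>"
  shows "flow_connected A G"
proof -
  have "real (card (branch_vertices (arcs G) (tail G) (head G))) \<le> real n - real n\<^sub>2"
    using card_branch_vertices_le[OF assms(1)] assms(3,4) by linarith
  then obtain r where "card (branch_vertices (arcs G) (tail G) (head G)) + 2 < 3 * 2 ^ r"
      "3 * r < CARD('a)" "1 < CARD('a)"
    using log_bound[OF assms(5)] by blast
  then show ?thesis
    using assms(1)
    by (intro flow_connected_of_connected_flows connected_flows_if_few_branch_vertices)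
      (simp_all add: fin_digraph.finite_arcs)
qed

end
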